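(* For $\alpha=\pm\frac12$, $\beta=\pm\frac12$ (and integers $k_1,k_2,j_1,j_2\ge0$), $$\langle P^{\alpha,\beta}_{k_1,k_2},P^{\alpha,\beta}_{j_1,j_2}\rangle_{w_{\alpha,\beta}}=d^{\alpha,\beta}_{k_1,k_2}\,\delta_{k_1,j_1}\delta_{k_2,j_2},$$ where - $d^{-\frac12,-\frac12}_{k_1,k_2}=1$ if $k_1=k_2=0$; $=\frac16$ if $k_1k_2=0$ and $k_1+k_2>0$; $=\frac1{12}$ if $k_1>0$ and $k_2>0$; - $d^{\frac12,-\frac12}_{k_1,k_2}=\frac16$ if $k_1\ge0$, $k_2=0$; $=\frac1{12}$ if $k_1\ge0$, $k_2>0$; - $d^{-\frac12,\frac12}_{k_1,k_2}=\frac16$ if $k_1=0$, $k_2\ge0$; $=\frac1{12}$ if $k_1>0$, $k_2\ge0$; - $d^{\frac12,\frac12}_{k_1,k_2}=\frac1{12}$ for $k_1\ge0$, $k_2\ge0$.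
   Context: Throughout $\mathbf t=(t_1,t_2,t_3)\in\mathbb R^3$ with $t_1+t_2+t_3=0$. For $\mathbf k=(k_1,k_2,k_3)\in\mathbb Z^3$ with $k_1+k_2+k_3=0$ define $\mathsf{CC}_{\mathbf k}(\mathbf t)=\frac13\left[\cos\frac{\pi(k_1-k_3)(t_1-t_3)}3\cos\pi k_2t_2+\cos\frac{\pi(k_1-k_3)(t_2-t_1)}3\cos\pi k_2t_3+\cos\frac{\pi(k_1-k_3)(t_3-t_2)}3\cos\pi k_2t_1\right]$; $\mathsf{SC}_{\mathbf k}$, $\mathsf{CS}_{\mathbf k}$, $\mathsf{SS}_{\mathbf k}$ are given by the same formula with each product $\cos(\cdot)\cos(\cdot)$ replaced by $\sin(\cdot)\cos(\cdot)$, $\cos(\cdot)\sin(\cdot)$, $\sin(\cdot)\sin(\cdot)$, respectively (same arguments in the same positions). Under the change of variables $x=\mathsf{CC}_{1,0,-1}(\mathbf t)$, $y=\mathsf{CC}_{1,1,-2}(\mathbf t)$ the generalized Chebyshev polynomials are, for $k_1,k_2\ge0$, $P^{-\frac12,-\frac12}_{k_1,k_2}(x,y)=\mathsf{CC}_{k_1+k_2,k_2,-k_1-2k_2}(\mathbf t)$, $P^{\frac12,-\frac12}_{k_1,k_2}(x,y)=\frac{\mathsf{SC}_{k_1+k_2+1,k_2,-k_1-2k_2-1}(\mathbf t)}{\mathsf{SC}_{1,0,-1}(\mathbf t)}$, $P^{-\frac12,\frac12}_{k_1,k_2}(x,y)=\frac{\mathsf{CS}_{k_1+k_2+1,k_2+1,-k_1-2k_2-2}(\mathbf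 t)}{\mathsf{CS}_{1,1,-2}(\mathbf t)}$, $P^{\frac12,\frac12}_{k_1,k_2}(x,y)=\frac{\mathsf{SS}_{k_1+k_2+2,k_2+1,-k_1-2k_2-3}(\mathbf t)}{\mathsf{SS}_{2,1,-3}(\mathbf t)}$; these are polynomials in $x,y$. $\triangle^*\subset\mathbb R^2$ is the image of $\triangle=\{\mathbf t:t_1+t_2+t_3=0,\ 0\le t_2\le t_1\le-t_3\le1\}$ under $\mathbf t\mapsto(x,y)$. The weight is $w_{\alpha,\beta}(x,y)=\frac{(4\pi^2)^{\alpha+\beta}}{3^{2\alpha+\beta}}(1+2y-3x^2)^\alpha(24x^3-y^2-12xy-6x-4y-1)^\beta$ (both factors nonnegative on $\triangle^*$), and $\langle f,g\rangle_{w_{\alpha,\beta}}=c_{\alpha,\beta}\int_{\triangle^*}f(x,y)\overline{g(x,y)}\,w_{\alpha,\beta}(x,y)\,dx\,dy$ with the normalization constant $c_{\alpha,\beta}=1/\int_{\triangle^*}w_{\alpha,\beta}(x,y)\,dx\,dy$. $\delta$ denotes the Kronecker delta.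
   Formalization: The constant d_{k1,k2} on the right is replaced by d_{k1,k2}/d_{0,0}: as P_{0,0}=1 and c=1/∫w, ⟨P_{0,0},P_{0,0}⟩=1, whereas the printed table gives 1/6, 1/6, 1/12 for (1/2,-1/2), (-1/2,1/2), (1/2,1/2). The case (-1/2,-1/2) and orthogonality are as printed. *)

theory Defs
  imports "HOL-Analysis.Analysis" "HOL-Computational_Algebra.Polynomial"
begin

text \<open>
  Points of the plane \<open>t1 + t2 + t3 = 0\<close> and indices with \<open>k1 + k2 + k3 = 0\<close> are passed as
  three separate arguments; the two constraints are imposed where the functions are used.
\<close>

definition gen_trig ::
  "(real \<Rightarrow> real) \<Rightarrow> (real \<Rightarrow> real) \<Rightarrow> int \<Rightarrow> int \<Rightarrow> int \<Rightarrow> real \<Rightarrow> real \<Rightarrow> real \<Rightarrow> real" where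
  "gen_trig f g k1 k2 k3 t1 t2 t3 = 1/3 *
     (f (pi * of_int (k1 - k3) * (t1 - t3) / 3) * g (pi * of_int k2 * t2)
    + f (pi * of_int (k1 - k3) * (t2 - t1) / 3) * g (pi * of_int k2 * t3)
    + f (pi * of_int (k1 - k3) * (t3 - t2) / 3) * g (pi * of_int k2 * t1))"

abbreviation "CC \<equiv> gen_trig cos cos"
abbreviation "SC \<equiv> gen_trig sin cos"
abbreviation "CS \<equiv> gen_trig cos sin"
abbreviation "SS \<equiv> gen_trig sin sin"

definition x_of :: "real \<Rightarrow> real \<Rightarrow> real \<Rightarrow> real" where
  "x_of t1 t2 t3 = CC 1 0 (-1) t1 t2 t3"

definition y_of :: "real \<Rightarrow> real \<Rightarrow> real \<Rightarrow> real" where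
  "y_of t1 t2 t3 = CC 1 1 (-2) t1 t2 t3"

definition cheb_num :: "real \<Rightarrow> real \<Rightarrow> nat \<Rightarrow> nat \<Rightarrow> real \<Rightarrow> real \<Rightarrow> real \<Rightarrow> real" where
  "cheb_num \<alpha> \<beta> k1 k2 =
    (let a = int k1; b = int k2 in
     if \<alpha> = -1/2 \<and> \<beta> = -1/2 then CC (a + b) b (- a - 2*b)
     else if \<alpha> = 1/2 \<and> \<beta> = -1/2 then SC (a + b + 1) b (- a - 2*b - 1)
     else if \<alpha> = -1/2 \<and> \<beta> = 1/2 then CS (a + b + 1) (b + 1) (- a - 2*b - 2)
     else SS (a + b + 2) (b + 1) (- a - 2*b - 3))"

definition cheb_den :: "real \<Rightarrow> real \<Rightarrow> real \<Rightarrow> real \<Rightarrow> real \<Rightarrow> real" where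
  "cheb_den \<alpha> \<beta> =
    (if \<alpha> = -1/2 \<and> \<beta> = -1/2 then (\<lambda>t1 t2 t3. 1)
     else if \<alpha> = 1/2 \<and> \<beta> = -1/2 then SC 1 0 (-1)
     else if \<alpha> = -1/2 \<and> \<beta> = 1/2 then CS 1 1 (-2)
     else SS 2 1 (-3))"

text \<open>
  A real polynomial in \<open>x\<close> and \<open>y\<close> is a polynomial in \<open>y\<close> (outer variable) with coefficients in
  \<open>\<real>[x]\<close> (inner variable).
\<close>

definition eval2 :: "real poly poly \<Rightarrow> real \<Rightarrow> real \<Rightarrow> real" where
  "eval2 p x y = poly (poly p [:y:]) x"

text \<open>
  The generalized Chebyshev polynomial is the unique polynomial that satisfies its trigonometric
  definition wherever the denominator does not vanish.
\<close>

definition cheb_poly :: "real \<Rightarrow> real \<Rightarrow> nat \<Rightarrow> nat \<Rightarrow> real poly poly" where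
  "cheb_poly \<alpha> \<beta> k1 k2 =
    (THE p. \<forall>t1 t2 t3. t1 + t2 + t3 = 0 \<and> cheb_den \<alpha> \<beta> t1 t2 t3 \<noteq> 0 \<longrightarrow>
       eval2 p (x_of t1 t2 t3) (y_of t1 t2 t3)
         = cheb_num \<alpha> \<beta> k1 k2 t1 t2 t3 / cheb_den \<alpha> \<beta> t1 t2 t3)"

definition cheb :: "real \<Rightarrow> real \<Rightarrow> nat \<Rightarrow> nat \<Rightarrow> real \<times> real \<Rightarrow> complex" where
  "cheb \<alpha> \<beta> k1 k2 z = complex_of_real (eval2 (cheb_poly \<alpha> \<beta> k1 k2) (fst z) (snd z))"

definition triangle :: "(real \<times> real \<times> real) set" where
  "triangle = {(t1, t2, t3). t1 + t2 + t3 = 0 \<and> 0 \<le> t2 \<and> t2 \<le> t1 \<and> t1 \<le> - t3 \<and> - t3 \<le> 1}"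

definition triangle_star :: "(real \<times> real) set" where
  "triangle_star = (\<lambda>(t1, t2, t3). (x_of t1 t2 t3, y_of t1 t2 t3)) ` triangle"

text \<open>
  Both bases are nonnegative on \<open>triangle_star\<close>.  Where a base is zero and the exponent is \<open>-1/2\<close>,
  \<open>powr\<close> gives \<open>0\<close>; this only happens on the boundary curves, a null set.
\<close>

definition weight :: "real \<Rightarrow> real \<Rightarrow> real \<times> real \<Rightarrow> real" where
  "weight \<alpha> \<beta> = (\<lambda>(x, y).
     (4 * pi^2) powr (\<alpha> + \<beta>) / 3 powr (2 * \<alpha> + \<beta>)
     * (1 + 2*y - 3*x^2) powr \<alpha>
     * (24*x^3 - y^2 - 12*x*y - 6*x - 4*y - 1) powr \<beta>)"

definition norm_const :: "real \<Rightarrow> real \<Rightarrow> real" where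
  "norm_const \<alpha> \<beta> = 1 / (LINT z:triangle_star|lborel. weight \<alpha> \<beta> z)"

definition weighted_inner ::
  "real \<Rightarrow> real \<Rightarrow> (real \<times> real \<Rightarrow> complex) \<Rightarrow> (real \<times> real \<Rightarrow> complex) \<Rightarrow> complex" where
  "weighted_inner \<alpha> \<beta> f g = complex_of_real (norm_const \<alpha> \<beta>) *
     (LINT z:triangle_star|lborel. f z * cnj (g z) * complex_of_real (weight \<alpha> \<beta> z))"

text \<open>
  The constants \<open>d\<close> are the squared norms of the numerators \<open>CC\<close>, \<open>SC\<close>, \<open>CS\<close>, \<open>SS\<close> in the
  normalized Lebesgue measure of \<open>triangle\<close>.  The inner product \<open>weighted_inner\<close> is instead
  normalized to give the constant polynomial \<open>1\<close>, which is the polynomial of index \<open>(0, 0)\<close> in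
  each of the four families, squared norm \<open>1\<close>.  The squared norm of the polynomial of index
  \<open>(k1, k2)\<close> is therefore \<open>d \<alpha> \<beta> k1 k2 / d \<alpha> \<beta> 0 0\<close>; the divisor is \<open>1\<close> for
  \<open>\<alpha> = \<beta> = -1/2\<close>, but \<open>1/6\<close> or \<open>1/12\<close> for the other three families.
\<close>

definition d :: "real \<Rightarrow> real \<Rightarrow> nat \<Rightarrow> nat \<Rightarrow> real" where
  "d \<alpha> \<beta> k1 k2 =
    (if \<alpha> = -1/2 \<and> \<beta> = -1/2 then
       (if k1 = 0 \<and> k2 = 0 then 1 else if k1 = 0 \<or> k2 = 0 then 1/6 else 1/12)
     else if \<alpha> = 1/2 \<and> \<beta> = -1/2 then (if k2 = 0 then 1/6 else 1/12)
     else if \<alpha> = -1/2 \<and> \<beta> = 1/2 then (if k1 = 0 then 1/6 else 1/12)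
     else 1/12)"

end

theory Submission
  imports Defs
begin

text \<open>
  In the coordinates \<open>p = 2\<pi>(t1 - t2)/3\<close>, \<open>q = 2\<pi>(t2 - t3)/3\<close> the functions \<open>CC\<close>, \<open>SC\<close>, \<open>CS\<close>, \<open>SS\<close>
  are, up to constants, the sums of \<open>\<chi>(w) exp(i w k \<cdot> (p, q))\<close> over the Weyl group of \<open>G\<^sub>2\<close> for its four
  linear characters \<open>\<chi>\<close>.  Two such sums with characters \<open>\<chi>\<close> and \<open>\<psi>\<close> multiply to a combination of sums
  with character \<open>\<chi> \<psi>\<close>.  Multiplication by \<open>x\<close> and \<open>y\<close> therefore shifts the weight, and induction on
  the length of the weight shows that every numerator is the denominator times a polynomial in
  \<open>(x, y)\<close>.  The Jacobian of \<open>(p, q) \<mapsto> (x, y)\<close> is a multiple of the product of the two denominators of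
  \<open>SC\<close> and \<open>CS\<close>, whose squares are, up to constants, the two factors of the
  weight function, so that the inner product is the integral of a product of two numerators
  over the fundamental chamber.  The product formula reduces this to
  the integrals of the invariant sums, which are eigenfunctions of the Laplacian with vanishing normal
  derivative on the boundary: they integrate to zero unless the weight is zero.
\<close>

subsection \<open>Weyl group sums\<close>

text \<open>A weight \<open>k\<close> with \<open>k1 + k2 + k3 = 0\<close> is encoded as \<open>(m, n) = (k1, - k3)\<close>.\<close>

definition expi :: "int \<Rightarrow> int \<Rightarrow> real \<times> real \<Rightarrow> complex" where
  "expi m n z = cis (of_int m * fst z + of_int n * snd z)"

definition rot_sum :: "int \<Rightarrow> int \<Rightarrow> real \<times> real \<Rightarrow> complex" where
  "rot_sum m n z = expi m n z + expi (n - m) (- m) z + expi (- n) (m - n) z"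

definition perm_sum :: "complex \<Rightarrow> int \<Rightarrow> int \<Rightarrow> real \<times> real \<Rightarrow> complex" where
  "perm_sum s m n z = rot_sum m n z + s * rot_sum (- n) (- m) z"

text \<open>The six weights \<open>(m, n)\<close>, \<open>(n - m, - m)\<close>, \<open>(- n, m - n)\<close>, \<open>(- n, - m)\<close>, \<open>(m, m - n)\<close>, \<open>(n - m, n)\<close>
  are the permutations of \<open>k\<close>, the last three being odd.  The parameters are the values of the
  character at a transposition (\<open>s\<close>) and at \<open>- 1\<close> (\<open>h\<close>).\<close>

definition weyl :: "complex \<Rightarrow> complex \<Rightarrow> int \<Rightarrow> int \<Rightarrow> real \<times> real \<Rightarrow> complex" where
  "weyl s h m n z = perm_sum s m n z + h * perm_sum s (- m) (- n) z"

section \<open>Products, conjugates and reflections of the sums\<close>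

lemma expi_mult: "expi a b z * expi m n z = expi (a + m) (b + n) z"
  by (simp add: expi_def cis_mult algebra_simps)

lemma cnj_expi: "cnj (expi m n z) = expi (- m) (- n) z"
  by (simp add: expi_def cis_cnj algebra_simps)

text \<open>The nine products of exponentials form three orbits of the cyclic group, one for each
  rotation of the second weight relative to the first.\<close>

lemma rot_sum_mult:
  "rot_sum a b z * rot_sum m n z = rot_sum (a + m) (b + n) z + rot_sum (a + n - m) (b - m) z
      + rot_sum (a - n) (b + m - n) z"
  unfolding rot_sum_def by (simp add: distrib_left distrib_right expi_mult)
      (simp add: algebra_simps)

lemma rot_sum_rotate: "rot_sum (n - m) (- m) z = rot_sum m n z" "rot_sum (- n) (m - n) z
    = rot_sum m n z"
  by (simp_all add: rot_sum_def algebra_simps)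

lemma cnj_rot_sum: "cnj (rot_sum m n z) = rot_sum (- m) (- n) z"
  by (simp add: rot_sum_def cnj_expi)

lemma cnj_weyl:
  assumes "s \<in> {1, -1}" "h \<in> {1, -1}"
  shows "cnj (weyl s h m n z) = h * weyl s h m n z"
  using assms by (auto simp: weyl_def perm_sum_def cnj_rot_sum algebra_simps)

text \<open>The map from \<open>(m, n)\<close> to \<open>(n - m, n)\<close> transposes
  \<open>k1\<close> and \<open>k2\<close>; its mirror is \<open>n = 2 * m\<close>.\<close>

lemma weyl_reflect1:
  assumes "s \<in> {1, -1}"
  shows "weyl s h (n - m) n z = s * weyl s h m n z"
  using assms rot_sum_rotate[of "-m" "-n" z] rot_sum_rotate[of m n z] rot_sum_rotate[of n m z]
      rot_sum_rotate[of "-n" "-m" z]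
  by (auto simp: weyl_def perm_sum_def algebra_simps)

text \<open>Exchanging \<open>m\<close> and \<open>n\<close> is the transposition of
  \<open>k1\<close> and \<open>k3\<close> followed by \<open>- 1\<close>, hence the factor
  \<open>s * h\<close>; its mirror is \<open>m = n\<close>.\<close>

lemma weyl_reflect2:
  assumes "s \<in> {1, -1}" "h \<in> {1, -1}"
  shows "weyl s h n m z = s * h * weyl s h m n z"
  using assms by (auto simp: weyl_def perm_sum_def algebra_simps)

lemma perm_sum_mult:
  assumes "s' \<in> {1, -1}"
  shows "perm_sum s a b z * perm_sum s' m n z =
    perm_sum (s * s') (a + m) (b + n) z + perm_sum (s * s') (a + n - m) (b - m) z
    + perm_sum (s * s') (a - n) (b + m - n) z
    + s' * (perm_sum (s * s') (a - n) (b - m) z + perm_sum (s * s') (a + m) (b + m - n) z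
      + perm_sum (s * s') (a + n - m) (b + n) z)"
proof -
  have "perm_sum s a b z * perm_sum s' m n z = rot_sum a b z * rot_sum m n z + s'
      * (rot_sum a b z * rot_sum (- n) (- m) z)
    + s * (rot_sum (- b) (- a) z * rot_sum m n z) + s * s' * (rot_sum (- b) (- a) z
        * rot_sum (- n) (- m) z)"
    unfolding perm_sum_def by (simp add: algebra_simps)
  then show ?thesis
    unfolding rot_sum_mult using assms by (auto simp: perm_sum_def algebra_simps)
qed

lemma perm_sum_mult_weyl:
  assumes "s' \<in> {1, -1}"
  shows "perm_sum s a b z * perm_sum s' m n z + h * (perm_sum s (- a) (- b) z * perm_sum s' (- m)
      (- n) z) =
    weyl (s * s') h (a + m) (b + n) z + weyl (s * s') h (a + n - m) (b - m) z
    + weyl (s * s') h (a - n) (b + m - n) z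
    + s' * (weyl (s * s') h (a - n) (b - m) z + weyl (s * s') h (a + m) (b + m - n) z
      + weyl (s * s') h (a + n - m) (b + n) z)"
proof -
  have "perm_sum s (- a) (- b) z * perm_sum s' (- m) (- n) z =
    perm_sum (s * s') (- (a + m)) (- (b + n)) z + perm_sum (s * s') (- (a + n - m)) (- (b - m)) z
    + perm_sum (s * s') (- (a - n)) (- (b + m - n)) z
    + s' * (perm_sum (s * s') (- (a - n)) (- (b - m)) z + perm_sum (s * s') (- (a + m)) (- (b + m
        - n)) z
      + perm_sum (s * s') (- (a + n - m)) (- (b + n)) z)"
    unfolding perm_sum_mult[OF assms] by (simp add: algebra_simps)
  then show ?thesis
    unfolding perm_sum_mult[OF assms] weyl_def
      by (simp only: distrib_left mult.left_commute ac_simps)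
qed

text \<open>A double sum over the group, reindexed by the relative element \<open>g\<close>: each of
  the twelve \<open>g\<close> contributes the sum of weight \<open>(a, b) + g (m, n)\<close> for the
  product character, times the second character at \<open>g\<close>.\<close>

lemma weyl_mult:
  assumes "s' \<in> {1, -1}" "h' \<in> {1, -1}"
  shows "weyl s h a b z * weyl s' h' m n z =
    weyl (s * s') (h * h') (a + m) (b + n) z + weyl (s * s') (h * h') (a + n - m) (b - m) z
    + weyl (s * s') (h * h') (a - n) (b + m - n) z
    + s' * (weyl (s * s') (h * h') (a - n) (b - m) z + weyl (s * s') (h * h') (a + m) (b + m - n)
        z
      + weyl (s * s') (h * h') (a + n - m) (b + n) z)
    + h' * (weyl (s * s') (h * h') (a - m) (b - n) z + weyl (s * s') (h * h') (a + m - n) (b + m)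
        z
      + weyl (s * s') (h * h') (a + n) (b + n - m) z)
    + s' * h' * (weyl (s * s') (h * h') (a + n) (b + m) z + weyl (s * s') (h * h') (a + m - n) (b
        - n) z
      + weyl (s * s') (h * h') (a - m) (b + n - m) z)"
proof -
  have "weyl s h a b z * weyl s' h' m n z =
    (perm_sum s a b z * perm_sum s' m n z + h * h' * (perm_sum s (- a) (- b) z
        * perm_sum s' (- m) (- n) z))
    + h' * (perm_sum s a b z * perm_sum s' (- m) (- n) z + h * h' * (perm_sum s (- a) (- b) z
        * perm_sum s' (- (- m)) (- (- n)) z))"
    using assms(2) unfolding weyl_def by (auto simp: algebra_simps)
  then show ?thesis
    unfolding perm_sum_mult_weyl[OF assms(1)]
      by (simp add: distrib_left mult.assoc mult.left_commute[of h'] diff_add_eq)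
qed

subsection \<open>Divisibility by the denominator\<close>

text \<open>Up to a factor, \<open>xpq\<close> and \<open>ypq\<close> are the orbit sums of the two
  fundamental weights of the root system: the short roots for \<open>xpq\<close>, the long roots for
  \<open>ypq\<close>.\<close>

definition xpq :: "real \<times> real \<Rightarrow> real" where
  "xpq z = (cos (fst z) + cos (snd z) + cos (fst z + snd z)) / 3"

definition ypq :: "real \<times> real \<Rightarrow> real" where
  "ypq z = (cos (snd z - fst z) + cos (2 * fst z + snd z) + cos (fst z + 2 * snd z)) / 3"

lemma weyl_x: "weyl 1 1 1 1 z = 12 * of_real (xpq z)"
  using cos_minus[of "fst z + snd z"] sin_minus[of "fst z + snd z"]
  by (simp add: weyl_def perm_sum_def rot_sum_def expi_def xpq_def complex_eq_iff algebra_simps)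

lemma weyl_y: "weyl 1 1 1 2 z = 12 * of_real (ypq z)"
  using cos_minus[of "fst z + 2 * snd z"] sin_minus[of "fst z + 2 * snd z"]
    cos_minus[of "2 * fst z + snd z"] sin_minus[of "2 * fst z + snd z"]
    cos_minus[of "fst z - snd z"] sin_minus[of "fst z - snd z"]
  by (simp add: weyl_def perm_sum_def rot_sum_def expi_def ypq_def complex_eq_iff algebra_simps)

text \<open>The weight \<open>(1, 1)\<close> lies on a wall, so the twelve terms of
  \<open>weyl_mult\<close> coincide in pairs. The same happens for \<open>(1, 2)\<close> in
  \<open>y_mult_weyl\<close>.\<close>

lemma x_mult_weyl:
  assumes "s \<in> {1, -1}" "h \<in> {1, -1}"
  shows "6 * of_real (xpq z) * weyl s h m n z = weyl s h (m + 1) (n + 1) z + weyl s h (m - 1) (n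
      - 1) z
    + weyl s h (m + 1) n z + weyl s h (m - 1) n z + weyl s h m (n + 1) z + weyl s h m (n - 1) z"
    (is "?l = ?r")
proof -
  have "2 * ?l = weyl s h m n z * weyl 1 1 1 1 z"
    by (simp add: weyl_x)
  also have "\<dots> = 2 * ?r"
    by (subst weyl_mult) (simp_all add: ac_simps)
  finally show ?thesis by (simp only: mult_cancel_left) simp
qed

lemma y_mult_weyl:
  assumes "s \<in> {1, -1}" "h \<in> {1, -1}"
  shows "6 * of_real (ypq z) * weyl s h m n z = weyl s h (m + 1) (n + 2) z + weyl s h (m - 1) (n
      - 2) z
    + weyl s h (m + 2) (n + 1) z + weyl s h (m - 2) (n - 1) z + weyl s h (m + 1) (n - 1) z
    + weyl s h (m - 1) (n + 1) z" (is "?l = ?r")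
proof -
  have "2 * ?l = weyl s h m n z * weyl 1 1 1 2 z"
    by (simp add: weyl_y)
  also have "\<dots> = 2 * ?r"
    by (subst weyl_mult) (simp_all add: ac_simps)
  finally show ?thesis by (simp only: mult_cancel_left) simp
qed

text \<open>A product instead of a quotient, so that the relation also holds at zeros of the
  denominator and is preserved by linear combinations.\<close>

definition weyl_multiple :: "complex \<Rightarrow> complex \<Rightarrow> int \<Rightarrow> int \<Rightarrow> (real \<times> real \<Rightarrow> complex) \<Rightarrow> bool" where
  "weyl_multiple s h r1 r2 f \<longleftrightarrow>
    (\<exists>P. \<forall>z. f z = weyl s h r1 r2 z * of_real (eval2 P (xpq z) (ypq z)))"

section \<open>Closure properties of the multiples of a denominator\<close>

lemma eval2_simps [simp]:
  "eval2 0 x y = 0" "eval2 (p + q) x y = eval2 p x y + eval2 q x y"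
  "eval2 (p * q) x y = eval2 p x y * eval2 q x y" "eval2 [:c:] x y = poly c x"
  "eval2 (p - q) x y = eval2 p x y - eval2 q x y"
  "eval2 [:0, 1:] x y = y"
  by (simp_all add: eval2_def)

lemma weyl_multiple_add: "weyl_multiple s h a b f \<Longrightarrow> weyl_multiple s h a b g
    \<Longrightarrow> weyl_multiple s h a b (\<lambda>z. f z + g z)"
  unfolding weyl_multiple_def
proof (elim exE)
  fix P Q
  assume "\<forall>z. f z = weyl s h a b z * of_real (eval2 P (xpq z) (ypq z))"
    and "\<forall>z. g z = weyl s h a b z * of_real (eval2 Q (xpq z) (ypq z))"
  then show "\<exists>P. \<forall>z. f z + g z = weyl s h a b z * of_real (eval2 P (xpq z) (ypq z))"
    by (intro exI[of _ "P + Q"]) (simp add: algebra_simps)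
qed

lemma weyl_multiple_mult:
  assumes "weyl_multiple s h a b f"
  shows "weyl_multiple s h a b (\<lambda>z. of_real (eval2 Q (xpq z) (ypq z)) * f z)"
proof -
  from assms obtain P where "\<forall>z. f z = weyl s h a b z * of_real (eval2 P (xpq z) (ypq z))"
    unfolding weyl_multiple_def by blast
  then show ?thesis
    unfolding weyl_multiple_def by (intro exI[of _ "Q * P"]) (simp add: algebra_simps)
qed

lemma weyl_multiple_x: "weyl_multiple s h a b f \<Longrightarrow> weyl_multiple s h a b (\<lambda>z. of_real (xpq z)
    * f z)"
  using weyl_multiple_mult[of s h a b f "[:[:0, 1:]:]"] by simp

lemma weyl_multiple_y: "weyl_multiple s h a b f \<Longrightarrow> weyl_multiple s h a b (\<lambda>z. of_real (ypq z)
    * f z)"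
  using weyl_multiple_mult[of s h a b f "[:0, 1:]"] by simp

lemma weyl_multiple_scale: "weyl_multiple s h a b f \<Longrightarrow> weyl_multiple s h a b (\<lambda>z. of_real c * f z)"
  using weyl_multiple_mult[of s h a b f "[:[:c:]:]"] by simp

lemma weyl_multiple_diff: "weyl_multiple s h a b f \<Longrightarrow> weyl_multiple s h a b g
    \<Longrightarrow> weyl_multiple s h a b (\<lambda>z. f z - g z)"
  using weyl_multiple_add[of s h a b f "\<lambda>z. of_real (-1) * g z"] weyl_multiple_scale[of s h a b g
      "-1"] by simp

lemma weyl_multiple_zero: "weyl_multiple s h a b (\<lambda>z. 0)"
  unfolding weyl_multiple_def by (intro exI[of _ 0]) simp

lemma weyl_multiple_self: "weyl_multiple s h a b (weyl s h a b)"
  unfolding weyl_multiple_def by (intro exI[of _ "[:[:1:]:]"]) simp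

text \<open>The images of the closed dominant chamber under the twelve group elements cover the
  plane. All twelve elements are composed of the two simple reflections, which keep the norm and
  change the sum by a sign only.\<close>

lemma dominant_representative:
  assumes s: "s \<in> {1, -1}" and h: "h \<in> {1, -1}"
  obtains m' n' c where "m' \<le> n'" "n' \<le> 2 * m'" "c \<in> {1, -1}"
    "m' * m' - m' * n' + n' * n' = m * m - m * n + n * n"
    "\<And>z. weyl s h m n z = complex_of_real c * weyl s h m' n' z"
proof -
  define R where "R = (\<lambda>(m, n) (m', n'). m' * m' - m' * n' + n' * n' = m * m - m * n + n * n \<and>
    (\<exists>c\<in>{1, -1}. \<forall>z. weyl s h m n z = complex_of_real c * weyl s h m' n' z))"
  have R1: "R (m, n) (n - m, n)" for m n
    unfolding R_def using s weyl_reflect1[OF s, of h n m] by (auto simp: algebra_simps)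
  have R2: "R (m, n) (n, m)" for m n
    unfolding R_def using s h weyl_reflect2[OF s h, of n m] by (auto simp: algebra_simps)
  have trans: "R u w" if "R u v" "R v w" for u v w
    using that unfolding R_def by (auto split: prod.splits)
  have rfl: "R u u" for u
    unfolding R_def by (auto split: prod.splits intro: bexI[of _ 1])
  have R3: "R (m, n) (n, n - m)" for m n
    using trans[OF R1 R2] by simp
  have R4: "R (m, n) (n - m, - m)" for m n
    using trans[OF R3 trans[OF R1 R2]] trans[OF R3 R3] by (simp add: algebra_simps)
  have R5: "R (m, n) (- m, - n)" for m n
    using trans[OF R4 R3, of m n] by (simp add: algebra_simps)
  have R6: "R (m, n) (m - n, m)" for m n
    using trans[OF R5 R4, of m n] by (simp add: algebra_simps)
  have R7: "R (m, n) (- n, m - n)" for m n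
    using trans[OF R5 R3, of m n] by (simp add: algebra_simps)
  have R8: "R (m, n) (- n, - m)" "R (m, n) (n - m, n)" "R (m, n) (m, m - n)"
    "R (m, n) (m - n, - n)" "R (m, n) (- m, n - m)" for m n
    using trans[OF R2 R5, of m n] trans[OF R1 R5, of m n] R1[of m n]
     trans[OF R6 R2, of m n] trans[OF R4 R2, of m n] by (simp_all add: algebra_simps)
  have "\<exists>m' n'. m' \<le> n' \<and> n' \<le> 2 * m' \<and> R (m, n) (m', n')"
  proof -
    \<comment> \<open>One case for each chamber; the six inequalities split on in the proof are
      those of the six mirrors.\<close>
    consider "m \<le> n \<and> n \<le> 2 * m" | "n \<le> m \<and> m \<le> 2 * n"
      | "n - m \<le> n \<and> n \<le> 2 * (n - m)" | "n \<le> n - m \<and> n - m \<le> 2 * n"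
      | "n - m \<le> - m \<and> - m \<le> 2 * (n - m)" | "- m \<le> n - m \<and> n - m \<le> 2 * (- m)"
      | "- m \<le> - n \<and> - n \<le> 2 * (- m)" | "- n \<le> - m \<and> - m \<le> 2 * (- n)"
      | "m - n \<le> - n \<and> - n \<le> 2 * (m - n)" | "- n \<le> m - n \<and> m - n \<le> 2 * (- n)"
      | "m - n \<le> m \<and> m \<le> 2 * (m - n)" | "m \<le> m - n \<and> m - n \<le> 2 * m"
      by (cases "m \<le> n"; cases "n \<le> 2 * m"; cases "m \<le> 2 * n"; cases "m + n \<ge> 0"; cases "m \<ge> 0";
          cases "n \<ge> 0") auto
    then show ?thesis
    proof cases
      case 1
      then show ?thesis using rfl by blast
    next
      case 2
      then show ?thesis using R2 by blast
    next
      case 3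
      then show ?thesis using R1 by blast
    next
      case 4
      then show ?thesis using R3 by blast
    next
      case 5
      then show ?thesis using R4 by blast
    next
      case 6
      then show ?thesis using R8(5) by blast
    next
      case 7
      then show ?thesis using R5 by blast
    next
      case 8
      then show ?thesis using R8(1) by blast
    next
      case 9
      then show ?thesis using R8(4) by blast
    next
      case 10
      then show ?thesis using R7 by blast
    next
      case 11
      then show ?thesis using R6 by blast
    next
      case 12
      then show ?thesis using R8(3) by blast
    qed
  qed
  then obtain m' n' where dom: "m' \<le> n'" "n' \<le> 2 * m'" and "R (m, n) (m', n')" by blast
  then obtain c where "c \<in> {1, -1}" "\<forall>z. weyl s h m n z = complex_of_real c * weyl s h m' n' z"
    "m' * m' - m' * n' + n' * n' = m * m - m * n + n * n"
    unfolding R_def by blast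
  with dom that show thesis by blast
qed

text \<open>Induction on the Weyl-invariant norm of the weight.  For a dominant weight \<open>(m, n)\<close> that is neither
  the Weyl vector nor on a wall where the sum vanishes, multiplying the sum of weight
  \<open>(m - 1, n - 1)\<close> by \<open>x\<close>, or that of weight \<open>(m - 1, n - 2)\<close> by \<open>y\<close>, gives a positive multiple of the sum of
  weight \<open>(m, n)\<close> plus sums of shorter weights; the multiple exceeds \<open>1\<close> if the factor lies on a wall.\<close>

lemma weyl_is_multiple:
  assumes s: "s \<in> {1, -1}" and h: "h \<in> {1, -1}"
    and a: "a = (if s = 1 then 0 else 1)" and b: "b = (if s * h = 1 then 0 else 1)"
  shows "weyl_multiple s h (a + b) (a + 2 * b) (weyl s h m n)"
proof -
  let ?M = "\<lambda>m n. weyl_multiple s h (a + b) (a + 2 * b) (weyl s h m n)"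
  define Q :: "int \<Rightarrow> int \<Rightarrow> int" where "Q = (\<lambda>m n. m * m - m * n + n * n)"
  have Q_nonneg: "0 \<le> Q m n" for m n
  proof -
    have "4 * Q m n = (2 * m - n)\<^sup>2 + 3 * n\<^sup>2"
      by (simp add: Q_def power2_eq_square algebra_simps)
    then show ?thesis
      by (metis add_nonneg_nonneg mult_nonneg_nonneg zero_le_mult_iff zero_le_numeral
          zero_le_power2
          not_numeral_le_zero zero_less_numeral)
  qed
  \<comment> \<open>The induction ranges over all weights, because the recurrences below produce
    shorter weights outside the dominant chamber.\<close>
  have "\<forall>m n. nat (Q m n) = N \<longrightarrow> ?M m n" for N
  proof (induction N rule: less_induct)
    case (less N)
    have IH: "?M m' n'" if "Q m' n' < Q m n" "nat (Q m n) = N" for m n m' n'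
      using less.IH[of "nat (Q m' n')"] that Q_nonneg[of m' n'] by auto
    have dominant: "?M m n" if dom: "m \<le> n" "n \<le> 2 * m" and N: "nat (Q m n) = N" for m n
    proof -
      have IH': "?M m' n'" if "Q m' n' < Q m n" for m' n'
        using IH that N by blast
      \<comment> \<open>The weights \<open>(m - 1, n)\<close> of \<open>x_rec\<close> and
        \<open>(m + 1, n - 1)\<close> of \<open>y_rec\<close> are left out: they are as long as
        \<open>(m, n)\<close> if \<open>2 * m - n = 1\<close> or \<open>n - m = 1\<close>,
        respectively. The exceptions \<open>(1, 1)\<close> and \<open>(1, 2)\<close> are the weights
        for which a recurrence returns the opposite weight, again of equal length.\<close>
      have x_rest: "?M (m - 2) (n - 2)" "?M m (n - 1)" "?M (m - 2) (n - 1)" "?M (m - 1) (n - 2)"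
        if "2 * m - n \<ge> 1" "(m, n) \<noteq> (1, 1)"
        using that dom by (intro IH'; simp add: Q_def algebra_simps; linarith)+
      have y_rest: "?M (m - 2) (n - 4)" "?M (m - 3) (n - 3)" "?M m (n - 3)" "?M (m - 2) (n - 1)"
        if "n - m \<ge> 1" "(m, n) \<noteq> (1, 2)"
        using that dom by (intro IH'; simp add: Q_def algebra_simps; linarith)+
      have x_rec: "weyl s h m n z = 6 * (of_real (xpq z) * weyl s h (m - 1) (n - 1) z)
          - weyl s h (m - 2) (n - 2) z
          - weyl s h m (n - 1) z - weyl s h (m - 2) (n - 1) z - weyl s h (m - 1) (n - 2) z
              - weyl s h (m - 1) n z" for z
        using x_mult_weyl[OF s h, of z "m - 1" "n - 1"] by (simp add: algebra_simps)
      have y_rec: "weyl s h m n z = 6 * (of_real (ypq z) * weyl s h (m - 1) (n - 2) z)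
          - weyl s h (m - 2) (n - 4) z
          - weyl s h (m - 3) (n - 3) z - weyl s h m (n - 3) z - weyl s h (m - 2) (n - 1) z
          - weyl s h (m + 1) (n - 1) z" for z
        using y_mult_weyl[OF s h, of z "m - 1" "n - 2"] by (simp add: algebra_simps)
      have zero1: "?M m n" if "n = 2 * m" "s = - 1"
      proof -
        have "weyl s h m n = (\<lambda>z. 0)"
          using weyl_reflect1[OF s, of h n m] that by auto
        then show ?thesis by (simp add: weyl_multiple_zero)
      qed
      have zero2: "?M m n" if "n = m" "s * h = - 1"
      proof -
        have "weyl s h m n z = s * h * weyl s h m n z" for z
          using weyl_reflect2[OF s h, of m m z] that by simp
        then have "weyl s h m n = (\<lambda>z. 0)"
          using that by auto
        then show ?thesis by (simp add: weyl_multiple_zero)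
      qed
      have scaled: "?M m n" if "weyl_multiple s h (a + b) (a + 2 * b) (\<lambda>z. of_real c
          * weyl s h m n z)" "c \<noteq> 0" for c
        using weyl_multiple_scale[OF that(1), of "1 / c"] that(2) by simp
      have const: "weyl 1 1 0 0 z = 12" for z
        by (simp add: weyl_def perm_sum_def rot_sum_def expi_def)
      note intros = weyl_multiple_diff weyl_multiple_x weyl_multiple_y weyl_multiple_scale
      \<comment> \<open>\<open>2 * m - n\<close> and \<open>n - m\<close> are the coordinates of the
        weight with respect to the fundamental weights \<open>(1, 1)\<close> and
        \<open>(1, 2)\<close>; \<open>a\<close> and \<open>b\<close> are their least values off the
        walls where the sum vanishes.\<close>
      consider (w1) "n = 2 * m" "s = - 1" | (w2) "n = m" "s * h = - 1"
        | (rho) "m = a + b" "n = a + 2 * b" | (x) "2 * m - n > a" | (y) "n - m > b"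
      proof -
        have "2 * m - n \<ge> a \<or> n = 2 * m \<and> s = - 1" "n - m \<ge> b \<or> n = m \<and> s * h = - 1"
          using a b dom s h by (auto split: if_splits)
        then show thesis
          using that by (smt (verit))
      qed
      then show ?thesis
      proof cases
        case w1
        then show ?thesis by (rule zero1)
      next
        case w2
        then show ?thesis by (rule zero2)
      next
        case rho
        then show ?thesis by (simp add: weyl_multiple_self)
      next
        case x
        consider "s * h = - 1" "(m, n) = (1, 1)" | "s = 1" "h = 1" "(m, n) = (1, 1)"
          | "(m, n) \<noteq> (1, 1)" "2 * m - n \<ge> 2" | "(m, n) \<noteq> (1, 1)" "2 * m - n = 1" "s = 1"
        proof -
          have "2 * m - n \<ge> 2 \<or> 2 * m - n = 1 \<and> s = 1"
            using x a by (cases "s = 1") auto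
          moreover have "s = 1 \<Longrightarrow> h = 1 \<or> s * h = - 1"
            using h by auto
          ultimately show thesis
            using that by (cases "(m, n) = (1, 1)") auto
        qed
        then show ?thesis
        proof cases
          case 1
          then show ?thesis using zero2 by simp
        next
          case 2
          \<comment> \<open>For the trivial character the denominator is the constant
            \<open>12\<close>, and the sum of weight \<open>(1, 1)\<close> is \<open>12 * x\<close>
            itself.\<close>
          have "weyl_multiple s h (a + b) (a + 2 * b) (\<lambda>z. of_real (xpq z) * weyl s h (a + b) (a
              + 2 * b) z)"
            by (intro intros weyl_multiple_self)
          then show ?thesis
            using 2 a b by (simp add: weyl_x[abs_def] const mult.commute)
        next
          case 3
          have "?M (m - 1) n" "?M (m - 1) (n - 1)"
            using 3 dom by (intro IH'; simp add: Q_def algebra_simps)+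
          then have "weyl_multiple s h (a + b) (a + 2 * b) (\<lambda>z. of_real 6 * (of_real (xpq z)
              * weyl s h (m - 1) (n - 1) z)
            - weyl s h (m - 2) (n - 2) z - weyl s h m (n - 1) z - weyl s h (m - 2) (n - 1) z
            - weyl s h (m - 1) (n - 2) z - weyl s h (m - 1) n z)"
            using x_rest 3 by (intro intros) auto
          then show ?thesis
            using x_rec[abs_def] by simp
        next
          case 4
          \<comment> \<open>Here \<open>(m - 1, n)\<close> is the mirror image of
            \<open>(m, n)\<close>, so the term left out of \<open>x_rest\<close> doubles the wanted
            sum.\<close>
          then have eq: "n - m = m - 1" by simp
          then have tie: "weyl s h (m - 1) n z = weyl s h m n z" for z
            using weyl_reflect1[OF s, of h n m z, unfolded eq] 4 by simp
          have "?M (m - 1) (n - 1)"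
            using 4 dom by (intro IH'; simp add: Q_def algebra_simps)
          then have "weyl_multiple s h (a + b) (a + 2 * b) (\<lambda>z. of_real 6 * (of_real (xpq z)
              * weyl s h (m - 1) (n - 1) z)
            - weyl s h (m - 2) (n - 2) z - weyl s h m (n - 1) z - weyl s h (m - 2) (n - 1) z
            - weyl s h (m - 1) (n - 2) z)"
            using x_rest 4 by (intro intros) auto
          moreover have "of_real 6 * (of_real (xpq z) * weyl s h (m - 1) (n - 1) z)
            - weyl s h (m - 2) (n - 2) z - weyl s h m (n - 1) z - weyl s h (m - 2) (n - 1) z
            - weyl s h (m - 1) (n - 2) z = of_real 2 * weyl s h m n z" for z
            using x_rec[of z] unfolding tie by (simp add: algebra_simps)
          ultimately show ?thesis
            using scaled[of 2] by simp
        qed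
      next
        case y
        consider "s = - 1" "(m, n) = (1, 2)" | "s = 1" "h = 1" "(m, n) = (1, 2)"
          | "(m, n) \<noteq> (1, 2)" "n - m \<ge> 2" | "(m, n) \<noteq> (1, 2)" "n - m = 1" "s * h = 1"
        proof -
          have "n - m \<ge> 2 \<or> n - m = 1 \<and> s * h = 1"
            using y b by (cases "s * h = 1") auto
          moreover have "s * h = 1 \<Longrightarrow> s = 1 \<and> h = 1 \<or> s = - 1"
            using s h by auto
          ultimately show thesis
            using that by (cases "(m, n) = (1, 2)") auto
        qed
        then show ?thesis
        proof cases
          case 1
          then show ?thesis using zero1 by simp
        next
          case 2
          have "weyl_multiple s h (a + b) (a + 2 * b) (\<lambda>z. of_real (ypq z) * weyl s h (a + b) (a
              + 2 * b) z)"
            by (intro intros weyl_multiple_self)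
          then show ?thesis
            using 2 a b by (simp add: weyl_y[abs_def] const mult.commute)
        next
          case 3
          have "?M (m + 1) (n - 1)" "?M (m - 1) (n - 2)"
            using 3 dom by (intro IH'; simp add: Q_def algebra_simps)+
          then have "weyl_multiple s h (a + b) (a + 2 * b) (\<lambda>z. of_real 6 * (of_real (ypq z)
              * weyl s h (m - 1) (n - 2) z)
            - weyl s h (m - 2) (n - 4) z - weyl s h (m - 3) (n - 3) z - weyl s h m (n - 3) z
            - weyl s h (m - 2) (n - 1) z - weyl s h (m + 1) (n - 1) z)"
            using y_rest 3 by (intro intros) auto
          then show ?thesis
            using y_rec[abs_def] by simp
        next
          case 4
          \<comment> \<open>Likewise \<open>(m + 1, n - 1)\<close> is the image of
            \<open>(m, n)\<close> under the other simple reflection.\<close>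
          then have eq: "m + 1 = n" "n - 1 = m" by simp_all
          then have tie: "weyl s h (m + 1) (n - 1) z = weyl s h m n z" for z
            unfolding eq using weyl_reflect2[OF s h, of n m z] 4 by simp
          have "?M (m - 1) (n - 2)"
            using 4 dom by (intro IH'; simp add: Q_def algebra_simps)
          then have "weyl_multiple s h (a + b) (a + 2 * b) (\<lambda>z. of_real 6 * (of_real (ypq z)
              * weyl s h (m - 1) (n - 2) z)
            - weyl s h (m - 2) (n - 4) z - weyl s h (m - 3) (n - 3) z - weyl s h m (n - 3) z
            - weyl s h (m - 2) (n - 1) z)"
            using y_rest 4 by (intro intros) auto
          moreover have "of_real 6 * (of_real (ypq z) * weyl s h (m - 1) (n - 2) z)
            - weyl s h (m - 2) (n - 4) z - weyl s h (m - 3) (n - 3) z - weyl s h m (n - 3) z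
            - weyl s h (m - 2) (n - 1) z = of_real 2 * weyl s h m n z" for z
            using y_rec[of z] unfolding tie by (simp add: algebra_simps)
          ultimately show ?thesis
            using scaled[of 2] by simp
        qed
      qed
    qed
    show ?case
    proof (intro allI impI)
      fix m n assume N: "nat (Q m n) = N"
      obtain m' n' c where "m' \<le> n'" "n' \<le> 2 * m'" "Q m' n' = Q m n"
        and eq: "\<And>z. weyl s h m n z = complex_of_real c * weyl s h m' n' z"
        unfolding Q_def using dominant_representative[OF s h, of m n] by metis
      then have "?M m' n'"
        using dominant N by simp
      then have "weyl_multiple s h (a + b) (a + 2 * b) (\<lambda>z. complex_of_real c * weyl s h m' n' z)"
        by (rule weyl_multiple_scale)
      then show "?M m n"
        unfolding eq[symmetric] .
    qed
  qed
  then show ?thesis by blast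
qed

subsection \<open>The map from the chamber to the region\<close>

definition chamber :: "(real \<times> real) set" where
  "chamber = {z. 0 \<le> fst z \<and> fst z \<le> snd z \<and> fst z + 2 * snd z \<le> 2 * pi}"

definition xypq :: "real \<times> real \<Rightarrow> real \<times> real" where
  "xypq z = (xpq z, ypq z)"

text \<open>\<open>delta1\<close> and \<open>delta2\<close> are multiples of the denominators
  \<open>SC 1 0 (-1)\<close> and \<open>CS 1 1 (-2)\<close>, as \<open>weyl_denominators\<close>
  confirms.\<close>

definition delta1 :: "real \<times> real \<Rightarrow> real" where
  "delta1 z = sin (fst z) + sin (snd z) - sin (fst z + snd z)"

definition delta2 :: "real \<times> real \<Rightarrow> real" where
  "delta2 z = sin (snd z - fst z) + sin (2 * fst z + snd z) - sin (fst z + 2 * snd z)"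

section \<open>Injectivity on the chamber\<close>

lemma sorted_roots_unique:
  fixes a b c a' b' c' :: real
  assumes "a + b + c = a' + b' + c'" "a * b + b * c + a * c = a' * b' + b' * c' + a' * c'"
    "a * b * c = a' * b' * c'" "a \<ge> b" "b \<ge> c" "a' \<ge> b'" "b' \<ge> c'"
  shows "a = a'" "b = b'" "c = c'"
proof -
  have root: "(t - a) * (t - b) * (t - c) = (t - a') * (t - b') * (t - c')" for t
  proof -
    have "(t - a) * (t - b) * (t - c) = t^3 - (a + b + c) * t\<^sup>2 + (a * b + b * c + a * c) * t - a
        * b * c"
      by (simp add: algebra_simps power2_eq_square power3_eq_cube)
    also have "\<dots> = (t - a') * (t - b') * (t - c')"
      unfolding assms(1,2,3) by (simp add: algebra_simps power2_eq_square power3_eq_cube)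
    finally show ?thesis .
  qed
  \<comment> \<open>Both triples have the same set of roots, hence the same maximum and minimum. The
    sum then yields the middle root, whatever the multiplicities.\<close>
  have "a = a' \<or> a = b' \<or> a = c'" "c = a' \<or> c = b' \<or> c = c'"
    using root[of a] root[of c] by auto
  moreover have "a' = a \<or> a' = b \<or> a' = c" "c' = a \<or> c' = b \<or> c' = c"
    using root[of a'] root[of c'] by auto
  ultimately show "a = a'" "c = c'"
    using assms(4-7) by linarith+
  then show "b = b'" using assms(1) by simp
qed

text \<open>The elementary symmetric functions of \<open>cos p\<close>, \<open>cos q\<close>, \<open>cos (p + q)\<close> are determined by \<open>x\<close> and \<open>y\<close>.\<close>

lemma cos_sum_relations:
  fixes p q :: real
  defines "a \<equiv> cos p" and "b \<equiv> cos q" and "c \<equiv> cos (p + q)"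
  shows "3 * ypq (p, q) + 3 * xpq (p, q) = 2 * (a * b + b * c + a * c)"
    and "1 + 2 * (a * b * c) = a\<^sup>2 + b\<^sup>2 + c\<^sup>2"
proof -
  define s t where "s = sin p" and "t = sin q"
  have st: "s\<^sup>2 + a\<^sup>2 = 1" "t\<^sup>2 + b\<^sup>2 = 1"
    by (simp_all add: s_def t_def a_def b_def)
  have c: "c = a * b - s * t" "sin (p + q) = s * b + a * t"
    by (simp_all add: c_def cos_add sin_add s_def t_def a_def b_def)
  have "cos (q - p) = a * b + s * t"
    by (simp add: cos_diff s_def t_def a_def b_def)
  moreover have "cos (2 * p + q) = a * c - s * (s * b + a * t)"
    using cos_add[of p "p + q"] by (simp add: c a_def[symmetric] s_def[symmetric]
        c_def[symmetric])
  moreover have "cos (p + 2 * q) = b * c - t * (s * b + a * t)"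
    using cos_add[of q "p + q"] by (simp add: c b_def[symmetric] t_def[symmetric]
        c_def[symmetric] ac_simps)
  ultimately have ypq: "3 * ypq (p, q) = (a * b + s * t) + (a * c - s * (s * b + a * t))
      + (b * c - t * (s * b + a * t))"
    by (simp add: ypq_def)
  have xpq: "3 * xpq (p, q) = a + b + c"
    by (simp add: xpq_def a_def b_def c_def)
  show "3 * ypq (p, q) + 3 * xpq (p, q) = 2 * (a * b + b * c + a * c)"
    unfolding xpq ypq c using st by algebra
  show "1 + 2 * (a * b * c) = a\<^sup>2 + b\<^sup>2 + c\<^sup>2"
    unfolding c using st by algebra
qed

text \<open>This supplies the order for \<open>sorted_roots_unique\<close>. The third edge says
  \<open>q \<le> 2 * pi - (p + q)\<close>, so folding \<open>p + q\<close> back below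
  \<open>pi\<close> does not pass \<open>q\<close>.\<close>

lemma cos_decreasing_on_chamber:
  assumes "(p, q) \<in> chamber"
  shows "cos q \<le> cos p" "cos (p + q) \<le> cos q"
proof -
  have pq: "0 \<le> p" "p \<le> q" "p + 2 * q \<le> 2 * pi"
    using assms by (auto simp: chamber_def)
  show "cos q \<le> cos p"
    using pq by (intro cos_monotone_0_pi_le) auto
  show "cos (p + q) \<le> cos q"
  proof (cases "p + q \<le> pi")
    case True
    then show ?thesis using pq by (intro cos_monotone_0_pi_le) auto
  next
    case False
    have "cos (p + q) = cos (2 * pi - (p + q))"
      by (metis cos_2pi_minus)
    also have "\<dots> \<le> cos q"
      using pq False by (intro cos_monotone_0_pi_le) auto
    finally show ?thesis .
  qed
qed

lemma xypq_inj: "inj_on xypq chamber"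
proof (rule inj_onI; clarify)
  fix p q p' q'
  assume in_ch: "(p, q) \<in> chamber" "(p', q') \<in> chamber" and eq: "xypq (p, q) = xypq (p', q')"
  let ?c = "cos (p + q)" and ?c' = "cos (p' + q')"
  have xpq: "xpq (p, q) = xpq (p', q')" and ypq: "ypq (p, q) = ypq (p', q')"
    using eq by (auto simp: xypq_def)
  have e1: "cos p + cos q + ?c = cos p' + cos q' + ?c'"
    using xpq by (simp add: xpq_def)
  have e2: "cos p * cos q + cos q * ?c + cos p * ?c = cos p' * cos q' + cos q' * ?c' + cos p'
      * ?c'"
    using cos_sum_relations(1)[of p q] cos_sum_relations(1)[of p' q'] xpq ypq by simp
  \<comment> \<open>Writing the sum of squares through the first two symmetric functions shows that
    these determine the third.\<close>
  have "1 + 2 * (cos p * cos q * cos (p + q)) = (cos p + cos q + cos (p + q))\<^sup>2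
      - 2 * (cos p * cos q + cos q * cos (p + q) + cos p * cos (p + q))" for p q :: real
    using cos_sum_relations(2)[of p q] by (simp add: power2_eq_square algebra_simps)
  from this[of p q] this[of p' q'] have e3: "cos p * cos q * ?c = cos p' * cos q' * ?c'"
    unfolding e1 e2 by simp
  have "cos p = cos p'" "cos q = cos q'"
    using sorted_roots_unique[OF e1 e2 e3 cos_decreasing_on_chamber[OF in_ch(1)]
        cos_decreasing_on_chamber[OF in_ch(2)]] by auto
  moreover have "0 \<le> p" "p \<le> pi" "0 \<le> q" "q \<le> pi" "0 \<le> p'" "p' \<le> pi" "0 \<le> q'" "q' \<le> pi"
    using in_ch by (auto simp: chamber_def)
  ultimately show "p = p' \<and> q = q'"
    using cos_inj_pi by blast
qed

text \<open>The left side of the first identity is nine times the Jacobian determinant of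
  \<open>xypq\<close>. All three are polynomial identities in the sines and cosines of
  \<open>p\<close> and \<open>q\<close>, modulo \<open>s^2 + a^2 = 1\<close> and
  \<open>t^2 + b^2 = 1\<close>.\<close>

lemma jacobian_identity:
  "(sin p + sin (p + q)) * (sin (q - p) + sin (2 * p + q) + 2 * sin (p + 2 * q))
    - (sin q + sin (p + q)) * (2 * sin (2 * p + q) + sin (p + 2 * q) - sin (q - p))
    = delta1 (p, q) * delta2 (p, q)"
  and weight_factor1: "1 + 2 * ypq (p, q) - 3 * (xpq (p, q))\<^sup>2 = (delta1 (p, q))\<^sup>2 / 3"
  and weight_factor2: "24 * (xpq (p, q))^3 - (ypq (p, q))\<^sup>2 - 12 * xpq (p, q) * ypq (p, q) - 6
      * xpq (p, q)
      - 4 * ypq (p, q) - 1 = (delta2 (p, q))\<^sup>2 / 9"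
proof -
  define a b s t where "a = cos p" and "b = cos q" and "s = sin p" and "t = sin q"
  have st: "s\<^sup>2 = 1 - a\<^sup>2" "t\<^sup>2 = 1 - b\<^sup>2"
    by (simp_all add: s_def t_def a_def b_def sin_squared_eq)
  \<comment> \<open>Rules that make every polynomial linear in \<open>s\<close> and in
    \<open>t\<close>; the versions with \<open>u\<close> act inside longer products.\<close>
  have st_mult: "s * s = 1 - a * a" "s * (s * u) = (1 - a * a) * u"
    "t * t = 1 - b * b" "t * (t * u) = (1 - b * b) * u" for u
    using st by (simp_all add: power2_eq_square flip: mult.assoc)
  have 1: "cos (p + q) = a * b - s * t" "sin (p + q) = s * b + a * t"
    "cos (q - p) = a * b + s * t" "sin (q - p) = t * a - b * s"
    by (simp_all add: cos_add sin_add cos_diff sin_diff s_def t_def a_def b_def)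
  have 2: "cos (2 * p + q) = a * cos (p + q) - s * sin (p + q)"
    "sin (2 * p + q) = s * cos (p + q) + a * sin (p + q)"
    using cos_add[of p "p + q"] sin_add[of p "p + q"] by (simp_all add: s_def a_def)
  have 3: "cos (p + 2 * q) = b * cos (p + q) - t * sin (p + q)"
    "sin (p + 2 * q) = t * cos (p + q) + b * sin (p + q)"
    using cos_add[of q "p + q"] sin_add[of q "p + q"] by (simp_all add: t_def b_def ac_simps)
  define x where "x = a + b + (a * b - s * t)"
  define y where "y = a * b + s * t + (a * (a * b - s * t) - s * (s * b + a * t))
      + (b * (a * b - s * t) - t * (s * b + a * t))"
  have xpq: "xpq (p, q) = x / 3"
    by (simp add: xpq_def 1 x_def a_def[symmetric] b_def[symmetric])
  have ypq: "ypq (p, q) = y / 3"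
    by (simp add: ypq_def 1 2 3 y_def)
  have delta1: "delta1 (p, q) = s + t - (s * b + a * t)"
    by (simp add: delta1_def 1 s_def[symmetric] t_def[symmetric])
  have delta2: "delta2 (p, q) = (t * a - b * s) + (s * (a * b - s * t) + a * (s * b + a * t))
      - (t * (a * b - s * t) + b * (s * b + a * t))"
    by (simp add: delta2_def 1 2 3)
  show "(sin p + sin (p + q)) * (sin (q - p) + sin (2 * p + q) + 2 * sin (p + 2 * q))
    - (sin q + sin (p + q)) * (2 * sin (2 * p + q) + sin (p + 2 * q) - sin (q - p))
    = delta1 (p, q) * delta2 (p, q)"
    unfolding delta1 delta2 1 2 3 s_def[symmetric] t_def[symmetric]
    by (simp add: algebra_simps st_mult)
  have "3 + 2 * y - x\<^sup>2 = (delta1 (p, q))\<^sup>2"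
    unfolding delta1 x_def y_def by (simp add: power2_eq_square algebra_simps st_mult)
  then show "1 + 2 * ypq (p, q) - 3 * (xpq (p, q))\<^sup>2 = (delta1 (p, q))\<^sup>2 / 3"
    unfolding xpq ypq by (simp add: field_simps)
  have "8 * x^3 - y\<^sup>2 - 12 * x * y - 18 * x - 12 * y - 9 = (delta2 (p, q))\<^sup>2"
    unfolding delta2 x_def y_def by (simp add: power2_eq_square power3_eq_cube algebra_simps
        st_mult)
  then show "24 * (xpq (p, q))^3 - (ypq (p, q))\<^sup>2 - 12 * xpq (p, q) * ypq (p, q) - 6 * xpq (p, q)
      - 4 * ypq (p, q) - 1 = (delta2 (p, q))\<^sup>2 / 9"
    unfolding xpq ypq by (simp add: field_simps power2_eq_square power3_eq_cube)
qed

subsection \<open>Integrals of invariant sums\<close>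

lemma compact_chamber: "compact chamber"
proof -
  have "closed chamber"
    unfolding chamber_def by (intro closed_Collect_conj closed_Collect_le continuous_intros)
  moreover have "bounded chamber"
    by (rule bounded_subset[OF bounded_Times[OF bounded_closed_interval bounded_closed_interval],
        of _ 0 pi 0 pi])
       (auto simp: chamber_def)
  ultimately show ?thesis
    by (simp add: compact_eq_bounded_closed)
qed

lemma sets_chamber [measurable]: "chamber \<in> sets borel"
  using compact_chamber by (rule borel_compact)

lemma integrable_chamber:
  fixes f :: "real \<times> real \<Rightarrow> real"
  assumes "continuous_on UNIV f"
  shows "set_integrable lborel chamber f"
  unfolding set_integrable_def
  by (rule borel_integrable_compact[OF compact_chamber continuous_on_subset[OF assms]]) simp

lemma integral_Icc_FTC:
  fixes F f :: "real \<Rightarrow> real"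
  assumes "a \<le> b" "\<And>x. (F has_real_derivative f x) (at x)" "continuous_on UNIV f"
  shows "(LBINT x:{a..b}. f x) = F b - F a"
  unfolding set_lebesgue_integral_def
  using assms continuous_on_subset[OF assms(3)]
  by (intro integral_FTC_Icc) (auto simp: has_real_derivative_iff_has_vector_derivative
        intro: has_vector_derivative_at_within)

lemma integrable_Icc:
  fixes f :: "real \<Rightarrow> real"
  assumes "continuous_on UNIV f"
  shows "integrable lborel (\<lambda>x. indicator {a..b} x * f x)"
  using borel_integrable_compact[OF compact_Icc continuous_on_subset[OF assms], of a b] by simp

text \<open>The divergence theorem for a vector field \<open>(U, V)\<close> that is tangent to the three edges.\<close>

lemma chamber_divergence:
  fixes U V U' V' :: "real \<times> real \<Rightarrow> real"
  assumes U: "\<And>p q. ((\<lambda>p. U (p, q)) has_real_derivative U' (p, q)) (at p)"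
    and V: "\<And>p q. ((\<lambda>q. V (p, q)) has_real_derivative V' (p, q)) (at q)"
    and cont: "continuous_on UNIV U" "continuous_on UNIV V" "continuous_on UNIV U'"
        "continuous_on UNIV V'"
    and edge1: "\<And>q. U (0, q) = 0"
    and edge2: "\<And>p. U (p, p) = V (p, p)"
    and edge3: "\<And>p. U (p, pi - p / 2) = - 2 * V (p, pi - p / 2)"
  shows "(LINT z:chamber|lborel. U' z + V' z) = 0"
proof -
  have cont_comp: "continuous_on UNIV (\<lambda>t. W (f t, g t))"
    if "continuous_on UNIV W" "continuous_on UNIV f" "continuous_on UNIV g"
    for W :: "real \<times> real \<Rightarrow> real" and f g :: "real \<Rightarrow> real"
    using continuous_on_compose2[OF that(1) continuous_on_Pair[OF that(2,3)]] by simp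
  note int = integrable_chamber[OF cont(3)] integrable_chamber[OF cont(4)]
  have int': "integrable (lborel \<Otimes>\<^sub>M lborel) (\<lambda>(p, q). indicator chamber (p, q) * U' (p, q))"
     "integrable (lborel \<Otimes>\<^sub>M lborel) (\<lambda>(p, q). indicator chamber (p, q) * V' (p, q))"
    using int by (simp_all add: set_integrable_def lborel_prod split_def)
  \<comment> \<open>Integrals of \<open>U\<close> along the edge \<open>p = q\<close> and along the
    third edge, both parametrized by \<open>p\<close>; the two edges meet at
    \<open>p = 2 * pi / 3\<close>.\<close>
  define A where "A = (\<integral>p. indicator {0..2 * pi / 3} p * U (p, p) \<partial>lborel)"
  define B where "B = (\<integral>p. indicator {0..2 * pi / 3} p * U (p, pi - p / 2) \<partial>lborel)"

  have inner_U: "(\<integral>p. indicator chamber (p, q) * U' (p, q) \<partial>lborel)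
      = indicator {0..pi} q * U (min q (2 * pi - 2 * q), q)" for q
  proof -
    have "(\<lambda>p. indicator chamber (p, q) * U' (p, q))
        = (\<lambda>p. indicator {0..min q (2 * pi - 2 * q)} p *\<^sub>R U' (p, q))"
      by (auto simp: chamber_def indicator_def fun_eq_iff)
    moreover have "(LBINT p:{0..min q (2 * pi - 2 * q)}. U' (p, q))
        = indicator {0..pi} q * U (min q (2 * pi - 2 * q), q)"
    proof (cases "q \<in> {0..pi}")
      case True
      then show ?thesis
        by (subst integral_Icc_FTC[OF _ U cont_comp[OF cont(3)]]) (auto simp: edge1 intro!:
            continuous_intros)
    next
      case False
      then have "{0..min q (2 * pi - 2 * q)} = {}" by auto
      with False show ?thesis by (simp add: set_lebesgue_integral_def)
    qed
    ultimately show ?thesis by (simp add: set_lebesgue_integral_def)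
  qed
  have "(LINT z:chamber|lborel. U' z) = (\<integral>q. \<integral>p. indicator chamber (p, q) * U' (p, q) \<partial>lborel
      \<partial>lborel)"
    using lborel_pair.integral_snd[OF int'(1)]
    by (simp add: set_lebesgue_integral_def lborel_prod split_def)
  \<comment> \<open>The upper limit is \<open>q\<close> up to \<open>2 * pi / 3\<close> and
    \<open>2 * pi - 2 * q\<close> beyond. The second piece is written in terms of
    \<open>2 * pi + (- 2) * q\<close>, so that an affine substitution turns it into
    \<open>B / 2\<close>.\<close>
  also have "\<dots> = (\<integral>q. indicator {0..2 * pi / 3} q * U (q, q)
      + indicator {0..2 * pi / 3} (2 * pi + (- 2) * q) * U (2 * pi + (- 2) * q, pi
          - (2 * pi + (- 2) * q) / 2) \<partial>lborel)"
    unfolding inner_U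
  proof (intro integral_cong_AE)
    \<comment> \<open>At this point both indicators equal \<open>1\<close> and the value is counted
      twice.\<close>
    have "AE q in lborel. q \<noteq> 2 * pi / 3"
      by (rule AE_lborel_singleton)
    then show "AE q in lborel. indicator {0..pi} q * U (min q (2 * pi - 2 * q), q) =
       indicator {0..2 * pi / 3} q * U (q, q)
      + indicator {0..2 * pi / 3} (2 * pi + (- 2) * q) * U (2 * pi + (- 2) * q, pi
          - (2 * pi + (- 2) * q) / 2)"
      by eventually_elim (auto simp: indicator_def min_def field_simps)
  next
    have [measurable]: "U \<in> borel_measurable borel"
      by (rule borel_measurable_continuous_onI[OF cont(1)])
    show "(\<lambda>q. indicator {0..pi} q * U (min q (2 * pi - 2 * q), q)) \<in> borel_measurable lborel"
      "(\<lambda>q. indicator {0..2 * pi / 3} q * U (q, q)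
      + indicator {0..2 * pi / 3} (2 * pi + (- 2) * q) * U (2 * pi + (- 2) * q, pi
          - (2 * pi + (- 2) * q) / 2)) \<in> borel_measurable lborel"
      by measurable
  qed
  also have "\<dots> = A + B / 2"
  proof -
    have iB: "integrable lborel (\<lambda>p. indicator {0..2 * pi / 3} p * U (p, pi - p / 2))"
      by (intro integrable_Icc cont_comp[OF cont(1)] continuous_intros) auto
    have iA: "integrable lborel (\<lambda>p. indicator {0..2 * pi / 3} p * U (p, p))"
      by (intro integrable_Icc cont_comp[OF cont(1)] continuous_intros)
    show ?thesis
      using iA lborel_integrable_real_affine[OF iB, of "- 2" "2 * pi"]
       lborel_integral_real_affine[of "- 2" "\<lambda>p. indicator {0..2 * pi / 3} p * U (p, pi - p / 2)"
           "2 * pi"]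
      by (subst Bochner_Integration.integral_add) (auto simp: A_def B_def)
  qed
  finally have int_U: "(LINT z:chamber|lborel. U' z) = A + B / 2" .

  have inner_V: "(\<integral>q. indicator chamber (p, q) * V' (p, q) \<partial>lborel)
      = indicator {0..2 * pi / 3} p * V (p, pi - p / 2) - indicator {0..2 * pi / 3} p
          * V (p, p)" for p
  proof -
    have "(\<lambda>q. indicator chamber (p, q) * V' (p, q))
        = (\<lambda>q. indicator {0..} p * (indicator {p..pi - p / 2} q *\<^sub>R V' (p, q)))"
      by (auto simp: chamber_def indicator_def fun_eq_iff)
    moreover have "indicator {0..} p * (LBINT q:{p..pi - p / 2}. V' (p, q))
        = indicator {0..2 * pi / 3} p * V (p, pi - p / 2) - indicator {0..2 * pi / 3} p
            * V (p, p)"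
    proof (cases "p \<in> {0..2 * pi / 3}")
      case True
      then show ?thesis
        by (subst integral_Icc_FTC[OF _ V cont_comp[OF cont(4)]]) (auto intro!: continuous_intros)
    next
      case False
      then have "p < 0 \<or> {p..pi - p / 2} = {}" by auto
      with False show ?thesis by (auto simp: set_lebesgue_integral_def)
    qed
    ultimately show ?thesis by (simp add: set_lebesgue_integral_def)
  qed
  have "(LINT z:chamber|lborel. V' z) = (\<integral>p. \<integral>q. indicator chamber (p, q) * V' (p, q) \<partial>lborel
      \<partial>lborel)"
    using lborel_pair.integral_fst[OF int'(2)]
    by (simp add: set_lebesgue_integral_def lborel_prod split_def)
  also have "\<dots> = (\<integral>p. indicator {0..2 * pi / 3} p * V (p, pi - p / 2) \<partial>lborel)
      - (\<integral>p. indicator {0..2 * pi / 3} p * V (p, p) \<partial>lborel)"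
    unfolding inner_V
    by (intro Bochner_Integration.integral_diff integrable_Icc cont_comp[OF cont(2)]
        continuous_intros) auto
  also have "\<dots> = - B / 2 - A"
  proof -
    have "V (p, pi - p / 2) = (- 1 / 2) * U (p, pi - p / 2)" for p
      using edge3[of p] by simp
    then have "(\<lambda>p. indicator {0..2 * pi / 3} p * V (p, pi - p / 2))
        = (\<lambda>p. (- 1 / 2) * (indicator {0..2 * pi / 3} p * U (p, pi - p / 2)))"
      by (auto simp: fun_eq_iff)
    then show ?thesis
      unfolding A_def B_def edge2 by simp
  qed
  finally have int_V: "(LINT z:chamber|lborel. V' z) = - B / 2 - A" .
  show ?thesis
    using int int_U int_V by (simp add: set_integral_add)
qed

section \<open>Invariant cosine sums\<close>

definition cos_form :: "int \<Rightarrow> int \<Rightarrow> real \<times> real \<Rightarrow> real" where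
  "cos_form i j z = cos (of_int i * fst z + of_int j * snd z)"

definition sin_form :: "int \<Rightarrow> int \<Rightarrow> real \<times> real \<Rightarrow> real" where
  "sin_form i j z = sin (of_int i * fst z + of_int j * snd z)"

text \<open>One cosine for each pair of opposite weights. The brackets pair \<open>(i, j)\<close>
  with \<open>(j - i, j)\<close> for the three rotations \<open>(i, j)\<close> of
  \<open>(m, n)\<close>.\<close>

definition cos_orbit :: "int \<Rightarrow> int \<Rightarrow> real \<times> real \<Rightarrow> real" where
  "cos_orbit m n z = cos_form m n z + cos_form (n - m) n z + (cos_form (n - m) (- m) z
     + cos_form (- n) (- m) z) + (cos_form (- n) (m - n) z + cos_form m (m - n) z)"

lemma weyl_eq_cos_orbit: "weyl 1 1 m n z = 2 * of_real (cos_orbit m n z)"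
proof -
  have pair: "expi i j z + expi (- i) (- j) z = 2 * of_real (cos_form i j z)" for i j
    using complex_add_cnj[of "expi i j z"]
      by (simp add: cnj_expi) (simp add: expi_def cos_form_def)
  have "weyl 1 1 m n z = (expi m n z + expi (- m) (- n) z) + (expi (n - m) n z + expi (- (n - m))
      (- n) z)
    + ((expi (n - m) (- m) z + expi (- (n - m)) (- (- m)) z) + (expi (- n) (- m) z
        + expi (- (- n)) (- (- m)) z))
    + ((expi (- n) (m - n) z + expi (- (- n)) (- (m - n)) z) + (expi m (m - n) z
        + expi (- m) (- (m - n)) z))"
    by (simp add: weyl_def perm_sum_def rot_sum_def)
  then show ?thesis
    unfolding pair cos_orbit_def by (simp add: distrib_left)
qed

lemma has_derivative_sin_form:
  "((\<lambda>p. sin_form i j (p, q)) has_real_derivative of_int i * cos_form i j (p, q)) (at p)"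
  "((\<lambda>q. sin_form i j (p, q)) has_real_derivative of_int j * cos_form i j (p, q)) (at q)"
  unfolding sin_form_def cos_form_def by (auto intro!: derivative_eq_intros)

lemma continuous_on_cos_form [continuous_intros]: "continuous_on S (cos_form i j)"
  unfolding cos_form_def[abs_def] by (intro continuous_intros)

lemma continuous_on_sin_form [continuous_intros]: "continuous_on S (sin_form i j)"
  unfolding sin_form_def[abs_def] by (intro continuous_intros)

lemma continuous_on_cos_orbit [continuous_intros]: "continuous_on S (cos_orbit m n)"
  unfolding cos_orbit_def[abs_def] by (intro continuous_intros)

text \<open>The vector field is the gradient \<open>(2 f\<^sub>p - f\<^sub>q, 2 f\<^sub>q - f\<^sub>p)\<close> of \<open>f = cos_orbit m n\<close> for the
  Weyl-invariant metric; its divergence is \<open>- 2 (m\<^sup>2 - m n + n\<^sup>2)\<close> times \<open>f\<close>.\<close>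

lemma integral_cos_orbit_eq_0:
  assumes "(m, n) \<noteq> (0, 0)"
  shows "(LINT z:chamber|lborel. cos_orbit m n z) = 0"
proof -
  \<comment> \<open>The gradient components contributed by the two cosines of indices
    \<open>(i, j)\<close> and \<open>(j - i, j)\<close>; \<open>S\<close> sums over the three
    rotations.\<close>
  define u v where "u = (\<lambda>i j z. real_of_int (j - 2 * i) * (sin_form i j z - sin_form (j - i) j
      z))"
    and "v = (\<lambda>i j z. real_of_int (i - 2 * j) * sin_form i j z - of_int (i + j) * sin_form (j
        - i) j z)"
  define u' v' where "u' = (\<lambda>i j z. real_of_int (j - 2 * i) * (i * cos_form i j z - (j - i)
      * cos_form (j - i) j z))"
    and "v' = (\<lambda>i j z. real_of_int (i - 2 * j) * j * cos_form i j z - of_int (i + j) * j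
        * cos_form (j - i) j z)"
  define S :: "(int \<Rightarrow> int \<Rightarrow> real \<times> real \<Rightarrow> real) \<Rightarrow> real \<times> real \<Rightarrow> real"
    where "S = (\<lambda>f z. f m n z + f (n - m) (- m) z + f (- n) (m - n) z)"
  define c where "c = - 2 * (m * m - m * n + n * n)"
  have c: "c \<noteq> 0"
  proof -
    have "4 * (m * m - m * n + n * n) = (2 * m - n)\<^sup>2 + 3 * n\<^sup>2"
      by (simp add: power2_eq_square algebra_simps)
    moreover have "(2 * m - n)\<^sup>2 + 3 * n\<^sup>2 > 0"
      using assms by (cases "n = 0") (auto intro: add_nonneg_pos)
    ultimately show ?thesis by (simp add: c_def)
  qed
  have sum: "S u' z + S v' z = of_int c * cos_orbit m n z" for z
    unfolding S_def u'_def v'_def c_def cos_orbit_def by (simp add: algebra_simps)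
  have "(LINT z:chamber|lborel. S u' z + S v' z) = 0"
  proof (rule chamber_divergence)
    show "((\<lambda>p. S u (p, q)) has_real_derivative S u' (p, q)) (at p)" for p q
      unfolding S_def u_def u'_def
      by (auto intro!: derivative_eq_intros has_derivative_sin_form simp: algebra_simps)
    show "((\<lambda>q. S v (p, q)) has_real_derivative S v' (p, q)) (at q)" for p q
      unfolding S_def v_def v'_def
      by (auto intro!: derivative_eq_intros has_derivative_sin_form simp: algebra_simps)
    show "continuous_on UNIV (S u)" "continuous_on UNIV (S v)" "continuous_on UNIV (S u')"
        "continuous_on UNIV (S v')"
      unfolding S_def u_def v_def u'_def v'_def by (intro continuous_intros)+
    show "S u (0, q) = 0" for q
      by (simp add: S_def u_def sin_form_def)
    have diag: "sin_form i j (p, p) = sin (of_int (i + j) * p)" for i j p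
      by (simp add: sin_form_def algebra_simps)
    show "S u (p, p) = S v (p, p)" for p
    proof -
      \<comment> \<open>On the diagonal only \<open>i + j\<close> matters, which matches each sine
        with the opposite of one from another orbit element.\<close>
      have "sin_form (- n) (- m) (p, p) = - sin_form m n (p, p)"
        "sin_form (n - m) n (p, p) = - sin_form (- n) (m - n) (p, p)"
        "sin_form m (m - n) (p, p) = - sin_form (n - m) (- m) (p, p)"
        unfolding diag sin_minus[symmetric] by (simp_all add: algebra_simps)
      then show ?thesis
        unfolding S_def u_def v_def by (simp add: algebra_simps)
    qed
    show "S u (p, pi - p / 2) = - 2 * S v (p, pi - p / 2)" for p
    proof -
      have reflect: "sin_form (j - i) j (p, pi - p / 2) = - sin_form i j (p, pi - p / 2)" for i j
      proof -
        define a where "a = (real_of_int i - j / 2) * p"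
        have "sin_form i j (p, pi - p / 2) = sin (a + j * pi)"
            "sin_form (j - i) j (p, pi - p / 2) = sin (- a + j * pi)"
          by (simp_all add: sin_form_def a_def algebra_simps)
        moreover have "sin (j * pi) = 0"
          by (simp add: mult.commute)
        ultimately show ?thesis
          unfolding sin_add by simp
      qed
      have "sin_form (n - m) n (p, pi - p / 2) = - sin_form m n (p, pi - p / 2)"
        "sin_form (- n) (- m) (p, pi - p / 2) = - sin_form (n - m) (- m) (p, pi - p / 2)"
        "sin_form m (m - n) (p, pi - p / 2) = - sin_form (- n) (m - n) (p, pi - p / 2)"
        using reflect[of n m] reflect[of "- m" "n - m"] reflect[of "m - n" "- n"] by simp_all
      then show ?thesis
        unfolding S_def u_def v_def by (simp add: algebra_simps)
    qed
  qed
  then show ?thesis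
    unfolding sum using c by simp
qed

subsection \<open>Change of variables in \<open>\<real> \<times> \<real>\<close>\<close>

text \<open>The two maps transport \<open>has_absolute_integral_change_of_variables\<close>, a
  statement about maps of \<open>real^n\<close>, to pairs.\<close>

definition vec_of_pair :: "real \<times> real \<Rightarrow> real^2" where
  "vec_of_pair z = (\<chi> i. if i = 1 then fst z else snd z)"

definition pair_of_vec :: "real^2 \<Rightarrow> real \<times> real" where
  "pair_of_vec v = (v $ 1, v $ 2)"

lemma pair_vec_inverse [simp]: "pair_of_vec (vec_of_pair z) = z" "vec_of_pair (pair_of_vec v) = v"
  by (auto simp: pair_of_vec_def vec_of_pair_def vec_eq_iff forall_2)

lemma bounded_linear_pair_of_vec: "bounded_linear pair_of_vec"
  unfolding pair_of_vec_def[abs_def]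
  by (intro bounded_linear_Pair bounded_linear_vec_nth)

lemma bounded_linear_vec_of_pair: "bounded_linear vec_of_pair"
  by (rule linear_conv_bounded_linear[THEN iffD1])
     (auto intro!: linearI simp: vec_of_pair_def vec_eq_iff)

lemma measurable_pair_of_vec [measurable]: "pair_of_vec \<in> borel_measurable borel"
  using bounded_linear_pair_of_vec
  by (intro borel_measurable_continuous_onI linear_continuous_on)

text \<open>Lebesgue measure is determined by its values on boxes, and the coordinate map preserves
  boxes and their side lengths.\<close>

lemma distr_pair_of_vec: "distr lborel borel pair_of_vec = lborel"
proof (rule lborel_eqI[symmetric])
  fix l u :: "real \<times> real"
  assume le: "\<And>b. b \<in> Basis \<Longrightarrow> l \<bullet> b \<le> u \<bullet> b"
  have le': "fst l \<le> fst u" "snd l \<le> snd u"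
    using le[of "(1, 0)"] le[of "(0, 1)"] by (auto simp: Basis_prod_def inner_prod_def)
  have box: "pair_of_vec -` box l u = box (vec_of_pair l) (vec_of_pair u)"
    by (auto simp: pair_of_vec_def vec_of_pair_def mem_box_cart forall_2 mem_box(1)[where 'a
        = "real \<times> real"]
        Basis_prod_def inner_prod_def)
  have "emeasure (distr lborel borel pair_of_vec) (box l u)
      = emeasure lborel (box (vec_of_pair l) (vec_of_pair u))"
    by (subst emeasure_distr) (simp_all add: box)
  also have "\<dots> = (\<Prod>b\<in>Basis. (vec_of_pair u - vec_of_pair l) \<bullet> b)"
    using le' by (intro emeasure_lborel_box) (auto simp: Basis_vec_def vec_of_pair_def inner_axis)
  also have "(\<Prod>b\<in>Basis. (vec_of_pair u - vec_of_pair l) \<bullet> b)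
      = (fst u - fst l) * (snd u - snd l)"
  proof -
    have basis: "(Basis :: (real^2) set) = {axis 1 1, axis 2 1}"
      by (auto simp: Basis_vec_def UNIV_2)
    show ?thesis
      unfolding basis by (simp add: axis_eq_axis inner_axis vec_of_pair_def)
  qed
  also have "\<dots> = (\<Prod>b\<in>Basis. (u - l) \<bullet> b)"
  proof -
    have basis: "(Basis :: (real \<times> real) set) = {(1, 0), (0, 1)}"
      by (auto simp: Basis_prod_def)
    show ?thesis
      unfolding basis by (simp add: inner_prod_def)
  qed
  finally show "emeasure (distr lborel borel pair_of_vec) (box l u)
      = ennreal (\<Prod>b\<in>Basis. (u - l) \<bullet> b)" .
qed simp

lemma set_integral_pair_of_vec:
  fixes f :: "real \<times> real \<Rightarrow> real"
  assumes [measurable]: "f \<in> borel_measurable borel" "S \<in> sets borel"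
  shows "set_integrable lborel S f \<longleftrightarrow> (\<lambda>v. f (pair_of_vec v)) absolutely_integrable_on
      (pair_of_vec -` S)"
    and "(LINT z:S|lborel. f z) = (LINT v:pair_of_vec -` S|lebesgue. f (pair_of_vec v))"
proof -
  have [measurable]: "(\<lambda>v. indicator S (pair_of_vec v) *\<^sub>R f (pair_of_vec v)) \<in> borel_measurable
      lborel"
    by measurable
  show "set_integrable lborel S f \<longleftrightarrow> (\<lambda>v. f (pair_of_vec v)) absolutely_integrable_on (pair_of_vec
      -` S)"
    unfolding set_integrable_def
    by (subst (1) distr_pair_of_vec[symmetric], subst integrable_distr_eq)
       (simp_all add: indicator_vimage integrable_completion)
  show "(LINT z:S|lborel. f z) = (LINT v:pair_of_vec -` S|lebesgue. f (pair_of_vec v))"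
    unfolding set_lebesgue_integral_def
    by (subst (1) distr_pair_of_vec[symmetric], subst integral_distr)
       (simp_all add: indicator_vimage integral_completion)
qed

text \<open>\<open>a\<close>, \<open>b\<close>, \<open>c\<close>, \<open>d\<close> are the entries
  of the Jacobian matrix. Integrability is asked of the pulled-back function on \<open>S\<close>; on
  the image it follows.\<close>

lemma integral_change_of_variables_pair:
  fixes f a b c d :: "real \<times> real \<Rightarrow> real" and g :: "real \<times> real \<Rightarrow> real \<times> real"
  assumes S: "S \<in> sets borel" and gS: "g ` S \<in> sets borel"
    and f [measurable]: "f \<in> borel_measurable borel"
    and der: "\<And>z. z \<in> S \<Longrightarrow> (g has_derivative (\<lambda>h. (a z * fst h + b z * snd h, c z * fst h + d z
        * snd h))) (at z within S)"
    and inj: "inj_on g S"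
    and meas [measurable]: "(\<lambda>z. \<bar>a z * d z - b z * c z\<bar> * f (g z)) \<in> borel_measurable borel"
    and int: "set_integrable lborel S (\<lambda>z. \<bar>a z * d z - b z * c z\<bar> * f (g z))"
  shows "(LINT z:g ` S|lborel. f z) = (LINT z:S|lborel. \<bar>a z * d z - b z * c z\<bar> * f (g z))"
proof -
  define J where "J = (\<lambda>z. a z * d z - b z * c z)"
  define S' where "S' = pair_of_vec -` S"
  define g2 where "g2 = vec_of_pair \<circ> g \<circ> pair_of_vec"
  define g2' where "g2' = (\<lambda>v. vec_of_pair \<circ> (\<lambda>h. (a (pair_of_vec v) * fst h + b (pair_of_vec v)
      * snd h,
    c (pair_of_vec v) * fst h + d (pair_of_vec v) * snd h)) \<circ> pair_of_vec)"
  have image: "pair_of_vec -` (g ` S) = g2 ` S'"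
  proof (intro set_eqI iffI)
    fix v assume "v \<in> pair_of_vec -` (g ` S)"
    then obtain z where "z \<in> S" "pair_of_vec v = g z" by auto
    then have "v = g2 (vec_of_pair z)" "vec_of_pair z \<in> S'"
      by (auto simp: g2_def S'_def) (metis pair_vec_inverse(2))
    then show "v \<in> g2 ` S'" by blast
  qed (auto simp: g2_def S'_def)
  have "S' \<in> sets borel"
    unfolding S'_def using measurable_sets[OF measurable_pair_of_vec S] by simp
  then have S'_leb: "S' \<in> sets lebesgue" by simp
  have der2: "(g2 has_derivative g2' v) (at v within S')" if "v \<in> S'" for v
    unfolding g2_def g2'_def o_assoc[symmetric]
  proof (intro diff_chain_within)
    show "(pair_of_vec has_derivative pair_of_vec) (at v within S')"
      using bounded_linear_pair_of_vec by (rule bounded_linear_imp_has_derivative)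
    show "(vec_of_pair has_derivative vec_of_pair) (at ((g \<circ> pair_of_vec) v) within
        (g \<circ> pair_of_vec) ` S')"
      using bounded_linear_vec_of_pair by (rule bounded_linear_imp_has_derivative)
    have "pair_of_vec ` S' = S"
      unfolding S'_def using pair_vec_inverse(1) by (intro surj_image_vimage_eq) (metis surjI)
    then show "(g has_derivative (\<lambda>h. (a (pair_of_vec v) * fst h + b (pair_of_vec v) * snd h,
      c (pair_of_vec v) * fst h + d (pair_of_vec v) * snd h))) (at (pair_of_vec v) within
          pair_of_vec ` S')"
      using der that by (auto simp: S'_def)
  qed
  have inj2: "inj_on g2 S'"
  proof (rule inj_onI)
    fix v w assume "v \<in> S'" "w \<in> S'" "g2 v = g2 w"
    then have "g (pair_of_vec v) = g (pair_of_vec w)"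
      unfolding g2_def o_apply by (metis pair_vec_inverse(1))
    then have "pair_of_vec v = pair_of_vec w"
      using inj \<open>v \<in> S'\<close> \<open>w \<in> S'\<close> by (auto simp: S'_def dest: inj_onD)
    then show "v = w" by (metis pair_vec_inverse(2))
  qed
  have det: "det (matrix (g2' v)) = J (pair_of_vec v)" for v
    by (simp add: det_2 matrix_def g2'_def vec_of_pair_def pair_of_vec_def J_def axis_def)
  have g2_eq: "f (pair_of_vec (g2 v)) = f (g (pair_of_vec v))" for v
    by (simp add: g2_def)
  have "(\<lambda>v. \<bar>J (pair_of_vec v)\<bar> * f (g (pair_of_vec v))) absolutely_integrable_on S'"
    using int set_integral_pair_of_vec(1)[OF meas S] unfolding S'_def J_def by simp
  \<comment> \<open>Real integrands are passed as vectors of length one.\<close>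
  then have "(\<lambda>v. \<bar>det (matrix (g2' v))\<bar> *\<^sub>R (\<chi> i::1. f (pair_of_vec (g2 v))))
      absolutely_integrable_on S'"
    by (simp add: absolutely_integrable_on_1_iff det g2_eq)
  then have *: "(\<lambda>v. f (pair_of_vec v)) absolutely_integrable_on (g2 ` S')"
    "integral (g2 ` S') (\<lambda>v. f (pair_of_vec v)) = integral S' (\<lambda>v. \<bar>J (pair_of_vec v)\<bar>
        * f (g (pair_of_vec v)))"
    using has_absolute_integral_change_of_variables[OF S'_leb der2 inj2,
        of "\<lambda>v. (\<chi> i::1. f (pair_of_vec v))" "integral S' (\<lambda>v. \<bar>det (matrix (g2' v))\<bar> *\<^sub>R
            (\<chi> i::1. f (pair_of_vec (g2 v))))"]
    by (simp_all add: absolutely_integrable_on_1_iff integral_on_1_eq det g2_eq vec_eq_iff)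
  have "(LINT z:g ` S|lborel. f z) = integral (g2 ` S') (\<lambda>v. f (pair_of_vec v))"
    using * by (simp add: set_integral_pair_of_vec(2)[OF f gS] image
        set_lebesgue_integral_eq_integral)
  also have "\<dots> = (LINT z:S|lborel. \<bar>J z\<bar> * f (g z))"
    using * int set_integral_pair_of_vec[OF meas S]
    by (simp add: J_def S'_def set_lebesgue_integral_eq_integral)
  finally show ?thesis by (simp add: J_def)
qed

subsection \<open>The generalized Chebyshev polynomials\<close>

lemma cis_plus_minus: "cis a + cis (- a) = 2 * of_real (cos a)" "cis a - cis (- a)
    = 2 * \<i> * of_real (sin a)"
  by (simp_all add: complex_eq_iff)

definition angles :: "real \<Rightarrow> real \<Rightarrow> real \<Rightarrow> real \<times> real" where
  "angles t1 t2 t3 = (2 * pi / 3 * (t1 - t2), 2 * pi / 3 * (t2 - t3))"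

text \<open>Each product of two binomials has four exponentials, and the three products exhaust the
  orbit of twelve. The signs \<open>s\<close> and \<open>s * h\<close> decide between cosine and
  sine in the first and in the second factor.\<close>

lemma weyl_angles:
  assumes "k1 + k2 + k3 = 0" "t1 + t2 + t3 = 0"
    and a_def: "a = (\<lambda>u. pi * of_int (k1 - k3) * u / 3)" and b_def: "b = (\<lambda>u. pi * of_int k2 * u)"
    and s: "s \<in> {1, -1}"
  shows "weyl s h k1 (- k3) (angles t1 t2 t3) =
      (cis (a (t1 - t3)) + s * cis (- a (t1 - t3))) * (cis (b t2) + s * h * cis (- b t2))
    + (cis (a (t2 - t1)) + s * cis (- a (t2 - t1))) * (cis (b t3) + s * h * cis (- b t3))
    + (cis (a (t3 - t2)) + s * cis (- a (t3 - t2))) * (cis (b t1) + s * h * cis (- b t1))"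
proof -
  have k3: "k3 = - k1 - k2" and t3: "t3 = - t1 - t2"
    using assms(1,2) by simp_all
  let ?z = "angles t1 t2 t3"
  have prod: "(cis x + s * cis (- x)) * (cis y + s * h * cis (- y))
      = cis (x + y) + s * cis (- x + y) + h * (cis (- (x + y)) + s * cis (- (- x + y)))" for x y
    using s by (auto simp: algebra_simps cis_mult)
  have expi: "expi i j ?z = cis (pi / 3 * (2 * i * (t1 - t2) + 2 * j * (t2 - t3)))" for i j
    unfolding expi_def angles_def fst_conv snd_conv
      by (rule arg_cong[of _ _ cis]) (simp add: field_simps)
  have neg: "expi (- i) (- j) ?z = cis (- x)" if "expi i j ?z = cis x" for i j x
    using cnj_expi[of i j ?z] that by (simp add: cis_cnj)
  have 1: "expi k1 (- k3) ?z = cis (a (t1 - t3) + b t2)" "expi k3 (- k1) ?z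
      = cis (- a (t1 - t3) + b t2)"
    "expi k3 (- k2) ?z = cis (a (t2 - t1) + b t3)" "expi k1 (- k2) ?z
        = cis (- a (t2 - t1) + b t3)"
    "expi k2 (- k1) ?z = cis (a (t3 - t2) + b t1)" "expi k2 (- k3) ?z
        = cis (- a (t3 - t2) + b t1)"
    unfolding expi unfolding a_def b_def k3 t3
      by (rule arg_cong[of _ _ cis]; simp add: field_simps)+
  have "weyl s h k1 (- k3) ?z = expi k1 (- k3) ?z + s * expi k3 (- k1) ?z + h
      * (expi (- k1) (- (- k3)) ?z + s * expi (- k3) (- (- k1)) ?z)
    + (expi k3 (- k2) ?z + s * expi k1 (- k2) ?z + h * (expi (- k3) (- (- k2)) ?z + s
        * expi (- k1) (- (- k2)) ?z))
    + (expi k2 (- k1) ?z + s * expi k2 (- k3) ?z + h * (expi (- k2) (- (- k1)) ?z + s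
        * expi (- k2) (- (- k3)) ?z))"
    by (simp add: weyl_def perm_sum_def rot_sum_def k3 algebra_simps)
  also have "\<dots> = (cis (a (t1 - t3)) + s * cis (- a (t1 - t3))) * (cis (b t2) + s * h
      * cis (- b t2))
    + (cis (a (t2 - t1)) + s * cis (- a (t2 - t1))) * (cis (b t3) + s * h * cis (- b t3))
    + (cis (a (t3 - t2)) + s * cis (- a (t3 - t2))) * (cis (b t1) + s * h * cis (- b t1))"
    unfolding prod 1 neg[OF 1(1)] neg[OF 1(2)] neg[OF 1(3)] neg[OF 1(4)] neg[OF 1(5)] neg[OF
        1(6)] by simp
  finally show ?thesis .
qed

lemma gen_trig_eq_weyl:
  assumes "k1 + k2 + k3 = 0" "t1 + t2 + t3 = 0"
  shows "complex_of_real (CC k1 k2 k3 t1 t2 t3) = weyl 1 1 k1 (- k3) (angles t1 t2 t3) / 12"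
    and "complex_of_real (SC k1 k2 k3 t1 t2 t3)
        = - \<i> * weyl (-1) (-1) k1 (- k3) (angles t1 t2 t3) / 12"
    and "complex_of_real (CS k1 k2 k3 t1 t2 t3) = - \<i> * weyl 1 (-1) k1 (- k3) (angles t1 t2 t3) /
        12"
    and "complex_of_real (SS k1 k2 k3 t1 t2 t3) = - weyl (-1) 1 k1 (- k3) (angles t1 t2 t3) / 12"
proof -
  define a b where "a = (\<lambda>u. pi * of_int (k1 - k3) * u / 3)" and "b = (\<lambda>u. pi * of_int k2 * u)"
  have trig: "gen_trig f g k1 k2 k3 t1 t2 t3 = (f (a (t1 - t3)) * g (b t2) + f (a (t2 - t1))
      * g (b t3)
      + f (a (t3 - t2)) * g (b t1)) / 3" for f g
    by (simp add: gen_trig_def a_def b_def)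
  note weyl = weyl_angles[OF assms a_def b_def]
  show "complex_of_real (CC k1 k2 k3 t1 t2 t3) = weyl 1 1 k1 (- k3) (angles t1 t2 t3) / 12"
    "complex_of_real (SC k1 k2 k3 t1 t2 t3) = - \<i> * weyl (-1) (-1) k1 (- k3) (angles t1 t2 t3) /
        12"
    "complex_of_real (CS k1 k2 k3 t1 t2 t3) = - \<i> * weyl 1 (-1) k1 (- k3) (angles t1 t2 t3) / 12"
    "complex_of_real (SS k1 k2 k3 t1 t2 t3) = - weyl (-1) 1 k1 (- k3) (angles t1 t2 t3) / 12"
    by (simp_all add: weyl trig cis_plus_minus algebra_simps)
qed

lemma angles_surj: "\<exists>t1 t2 t3. t1 + t2 + t3 = 0 \<and> angles t1 t2 t3 = z"
proof -
  obtain p q where z: "z = (p, q)" by fastforce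
  show ?thesis
    unfolding z
    by (rule exI[of _ "(2 * p + q) / (2 * pi)"], rule exI[of _ "(q - p) / (2 * pi)"],
        rule exI[of _ "- (p + 2 * q) / (2 * pi)"]) (simp add: angles_def field_simps)
qed

lemma x_of_eq: "t1 + t2 + t3 = 0 \<Longrightarrow> x_of t1 t2 t3 = xpq (angles t1 t2 t3)"
  using gen_trig_eq_weyl(1)[of 1 0 "-1" t1 t2 t3]
    by (simp add: x_of_def weyl_x del: of_real_eq_iff) (simp only: of_real_eq_iff)

lemma y_of_eq: "t1 + t2 + t3 = 0 \<Longrightarrow> y_of t1 t2 t3 = ypq (angles t1 t2 t3)"
  using gen_trig_eq_weyl(1)[of 1 1 "-2" t1 t2 t3]
    by (simp add: y_of_def weyl_y del: of_real_eq_iff) (simp only: of_real_eq_iff)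

lemma triangle_star_eq: "triangle_star = xypq ` chamber"
proof -
  have mem: "(t1, t2, t3) \<in> triangle \<longleftrightarrow> angles t1 t2 t3 \<in> chamber"
      if "t1 + t2 + t3 = 0" for t1 t2 t3
  proof -
    have t3: "t3 = - t1 - t2" using that by simp
    have pi_pos: "\<not> pi \<le> 0" by (simp add: not_le)
    have 1: "snd (angles t1 t2 t3) - fst (angles t1 t2 t3) = 2 * pi * t2"
      "fst (angles t1 t2 t3) + 2 * snd (angles t1 t2 t3) = 2 * pi * (- t3)"
      by (simp_all add: angles_def t3 field_simps)
    have "0 \<le> fst (angles t1 t2 t3) \<longleftrightarrow> 0 \<le> t1 - t2"
      by (simp add: angles_def zero_le_mult_iff pi_pos)
    moreover have "fst (angles t1 t2 t3) \<le> snd (angles t1 t2 t3) \<longleftrightarrow> 0 \<le> 2 * pi * t2"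
      unfolding 1(1)[symmetric] by simp
    moreover have "2 * pi * (- t3) \<le> 2 * pi * 1 \<longleftrightarrow> - t3 \<le> 1"
      by (subst mult_le_cancel_left_pos) simp_all
    ultimately have "angles t1 t2 t3 \<in> chamber \<longleftrightarrow> 0 \<le> t1 - t2 \<and> 0 \<le> t2 \<and> - t3 \<le> 1"
      unfolding chamber_def mem_Collect_eq 1(2) mult_1_right
        by (simp add: zero_le_mult_iff pi_pos)
    then show ?thesis
      using that by (auto simp: triangle_def)
  qed
  show ?thesis
  proof (intro set_eqI iffI)
    fix w assume "w \<in> triangle_star"
    then obtain t1 t2 t3 where t: "(t1, t2, t3) \<in> triangle" "w = (x_of t1 t2 t3, y_of t1 t2 t3)"
      unfolding triangle_star_def by auto
    then have "t1 + t2 + t3 = 0" by (simp add: triangle_def)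
    with t mem show "w \<in> xypq ` chamber"
      by (auto simp: xypq_def x_of_eq y_of_eq)
  next
    fix w assume "w \<in> xypq ` chamber"
    then obtain z where z: "z \<in> chamber" "w = xypq z" by auto
    obtain t1 t2 t3 where "t1 + t2 + t3 = 0" "angles t1 t2 t3 = z"
      using angles_surj by blast
    with z mem have "(t1, t2, t3) \<in> triangle" "w = (x_of t1 t2 t3, y_of t1 t2 t3)"
      by (auto simp: xypq_def x_of_eq y_of_eq)
    then show "w \<in> triangle_star"
      unfolding triangle_star_def by force
  qed
qed

lemma weyl_denominators:
  "weyl (-1) (-1) 1 1 z = - 4 * \<i> * of_real (delta1 z)"
  "weyl 1 (-1) 1 2 z = - 4 * \<i> * of_real (delta2 z)"
  "weyl (-1) 1 2 3 z = - 4 * of_real (delta1 z * delta2 z)"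
proof -
  show 1: "weyl (-1) (-1) 1 1 z = - 4 * \<i> * of_real (delta1 z)"
    using cos_minus[of "fst z + snd z"] sin_minus[of "fst z + snd z"]
    by (simp add: weyl_def perm_sum_def rot_sum_def expi_def delta1_def complex_eq_iff
        algebra_simps)
  show 2: "weyl 1 (-1) 1 2 z = - 4 * \<i> * of_real (delta2 z)"
    using cos_minus[of "fst z + 2 * snd z"] sin_minus[of "fst z + 2 * snd z"]
      cos_minus[of "2 * fst z + snd z"] sin_minus[of "2 * fst z + snd z"]
      cos_minus[of "fst z - snd z"] sin_minus[of "fst z - snd z"]
    by (simp add: weyl_def perm_sum_def rot_sum_def expi_def delta2_def complex_eq_iff
        algebra_simps)
  \<comment> \<open>In the expansion everything cancels except the orbit of
    \<open>(1, 1) + (1, 2) = (2, 3)\<close>.\<close>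
  have "weyl (-1) (-1) 1 1 z * weyl 1 (-1) 1 2 z = 4 * weyl (-1) 1 2 3 z"
    by (simp add: weyl_def perm_sum_def rot_sum_def algebra_simps expi_mult)
  then show "weyl (-1) 1 2 3 z = - 4 * of_real (delta1 z * delta2 z)"
    unfolding 1 2 by simp
qed

section \<open>Nonvanishing denominators and uniqueness of the polynomials\<close>

definition open_chamber :: "(real \<times> real) set" where
  "open_chamber = {z. 0 < fst z \<and> fst z < snd z \<and> fst z + 2 * snd z < 2 * pi}"

lemma open_chamber_subset: "open_chamber \<subseteq> chamber"
  by (auto simp: open_chamber_def chamber_def)

lemma sin_sum_factor: "sin x + sin y - sin (x + y) = 4 * sin (x / 2) * sin (y / 2)
    * sin ((x + y) / 2)" for x y :: real
proof -
  define a b where "a = x / 2" and "b = y / 2"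
  have "sin x + sin y - sin (x + y) = sin (2 * a) + sin (2 * b) - sin (2 * (a + b))"
    by (simp add: a_def b_def)
  also have "\<dots> = 4 * sin a * sin b * sin (a + b)"
  proof -
    have "(sin a)\<^sup>2 + (cos a)\<^sup>2 = 1" "(sin b)\<^sup>2 + (cos b)\<^sup>2 = 1" by simp_all
    then show ?thesis
      unfolding sin_double sin_add cos_add by algebra
  qed
  finally show ?thesis by (simp add: a_def b_def add_divide_distrib)
qed

text \<open>By \<open>sin_sum_factor\<close> both are products of three sines whose arguments lie
  strictly between \<open>0\<close> and \<open>pi\<close>.\<close>

lemma delta_nonzero:
  assumes "z \<in> open_chamber"
  shows "delta1 z \<noteq> 0" "delta2 z \<noteq> 0"
proof -
  obtain p q where z: "z = (p, q)" by fastforce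
  have pq: "0 < p" "p < q" "p + 2 * q < 2 * pi"
    using assms by (auto simp: open_chamber_def z)
  have pos: "sin u \<noteq> 0" if "0 < u" "u < pi" for u
    using sin_gt_zero[OF that] by simp
  show "delta1 z \<noteq> 0"
    using pq by (simp add: delta1_def z sin_sum_factor pos)
  have "delta2 z = 4 * sin ((q - p) / 2) * sin ((2 * p + q) / 2) * sin ((p + 2 * q) / 2)"
    using sin_sum_factor[of "q - p" "2 * p + q"] by (simp add: delta2_def z)
  moreover have "sin ((q - p) / 2) \<noteq> 0" "sin ((2 * p + q) / 2) \<noteq> 0" "sin ((p + 2 * q) / 2) \<noteq> 0"
    using pq by (intro pos; simp)+
  ultimately show "delta2 z \<noteq> 0" by simp
qed

text \<open>An open set contains a product of infinite sets \<open>A\<close> and \<open>B\<close>.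
  For \<open>y\<close> in \<open>B\<close> the polynomial in \<open>x\<close> has infinitely many
  roots and vanishes, so \<open>P\<close> has infinitely many roots \<open>[:y:]\<close> among the
  polynomials in \<open>x\<close>.\<close>

lemma polynomial_eq_0:
  assumes "open U" "U \<noteq> {}" "\<And>x y. (x, y) \<in> U \<Longrightarrow> eval2 P x y = 0"
  shows "P = 0"
proof -
  obtain x0 y0 where "(x0, y0) \<in> U"
    using assms(2) by fastforce
  then obtain A B where AB: "open A" "open B" "x0 \<in> A" "y0 \<in> B" "A \<times> B \<subseteq> U"
    using open_prod_elim[OF assms(1)] by (metis SigmaE2)
  have inf: "infinite A" "infinite B"
    using AB by (auto dest: finite_imp_not_open)
  have row: "poly P [:y:] = 0" if "y \<in> B" for y
  proof (rule ccontr)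
    assume "poly P [:y:] \<noteq> 0"
    then have "finite {x. poly (poly P [:y:]) x = 0}"
      by (rule poly_roots_finite)
    moreover have "A \<subseteq> {x. poly (poly P [:y:]) x = 0}"
      using assms(3) AB that by (auto simp: eval2_def)
    ultimately show False using inf finite_subset by blast
  qed
  show ?thesis
  proof (rule ccontr)
    assume "P \<noteq> 0"
    then have "finite {u. poly P u = 0}"
      by (rule poly_roots_finite)
    moreover have "(\<lambda>y. [:y:]) ` B \<subseteq> {u. poly P u = 0}"
      using row by auto
    moreover have "infinite ((\<lambda>y::real. [:y:]) ` B)"
      using inf by (subst finite_image_iff) (auto intro: inj_onI)
    ultimately show False using finite_subset by blast
  qed
qed

text \<open>By invariance of domain, the injective image of the open chamber is open.\<close>

lemma polynomial_unique:
  assumes "\<And>z. z \<in> open_chamber \<Longrightarrow> eval2 P (xpq z) (ypq z) = eval2 Q (xpq z) (ypq z)"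
  shows "P = Q"
proof -
  have "open open_chamber"
    unfolding open_chamber_def by (intro open_Collect_conj open_Collect_less continuous_intros)
  moreover have "continuous_on open_chamber xypq"
    unfolding xypq_def xpq_def ypq_def by (intro continuous_intros) auto
  moreover have "inj_on xypq open_chamber"
    using xypq_inj open_chamber_subset inj_on_subset by blast
  ultimately have "open (xypq ` open_chamber)"
    by (intro invariance_of_domain)
  moreover have "(pi / 4, pi / 2) \<in> open_chamber"
    by (simp add: open_chamber_def)
  then have "xypq ` open_chamber \<noteq> {}" by blast
  ultimately have "P - Q = 0"
    using assms by (intro polynomial_eq_0[of "xypq ` open_chamber"]) (auto simp: xypq_def)
  then show ?thesis by simp
qed

text \<open>\<open>wsign \<alpha>\<close> and \<open>wsign \<beta>\<close> are the values of the character at the two simple reflections, and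
  \<open>(wshift \<alpha>, wshift \<beta>)\<close> are the coordinates, in the fundamental weights, of the
  smallest dominant weight whose sum does not vanish.\<close>

definition wsign :: "real \<Rightarrow> real" where
  "wsign \<alpha> = (if \<alpha> = 1/2 then - 1 else 1)"

definition wshift :: "real \<Rightarrow> int" where
  "wshift \<alpha> = (if \<alpha> = 1/2 then 1 else 0)"

text \<open>With this \<open>h\<close> the product \<open>s * h\<close> is
  \<open>wsign \<beta>\<close>, the factor in \<open>weyl_reflect2\<close>.\<close>

definition cheb_weyl :: "real \<Rightarrow> real \<Rightarrow> nat \<Rightarrow> nat \<Rightarrow> real \<times> real \<Rightarrow> complex" where
  "cheb_weyl \<alpha> \<beta> k1 k2 = weyl (of_real (wsign \<alpha>)) (of_real (wsign \<alpha> * wsign \<beta>))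
     (int k1 + wshift \<alpha> + (int k2 + wshift \<beta>)) (int k1 + wshift \<alpha> + 2 * (int k2 + wshift \<beta>))"

lemma wsign_cases: "wsign \<alpha> \<in> {1, - 1}" "complex_of_real (wsign \<alpha>) \<in> {1, - 1}"
   "complex_of_real (wsign \<alpha> * wsign \<beta>) \<in> {1, - 1}"
  by (auto simp: wsign_def)

text \<open>The same \<open>\<kappa>\<close> serves numerator and denominator, so it drops out of
  the quotient.\<close>

lemma cheb_num_den:
  assumes "\<alpha> \<in> {-1/2, 1/2}" and "\<beta> \<in> {-1/2, 1/2}"
  obtains \<kappa> :: complex where "\<kappa> \<noteq> 0"
    "\<And>k1 k2 t1 t2 t3. t1 + t2 + t3 = 0 \<Longrightarrow>
      complex_of_real (cheb_num \<alpha> \<beta> k1 k2 t1 t2 t3) = \<kappa> * cheb_weyl \<alpha> \<beta> k1 k2 (angles t1 t2 t3)"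
    "\<And>t1 t2 t3. t1 + t2 + t3 = 0 \<Longrightarrow>
      complex_of_real (cheb_den \<alpha> \<beta> t1 t2 t3) = \<kappa> * cheb_weyl \<alpha> \<beta> 0 0 (angles t1 t2 t3)"
proof -
  have const: "weyl 1 1 0 0 z = 12" for z
    by (simp add: weyl_def perm_sum_def rot_sum_def expi_def)
  consider "\<alpha> = -1/2" "\<beta> = -1/2" | "\<alpha> = 1/2" "\<beta> = -1/2" | "\<alpha> = -1/2" "\<beta> = 1/2" | "\<alpha> = 1/2" "\<beta>
      = 1/2"
    using assms by auto
  then show thesis
  proof cases
    case 1
    have num: "cheb_num \<alpha> \<beta> k1 k2 = CC (int k1 + int k2) (int k2) (- int k1 - 2 * int k2)" for k1
        k2
      by (simp add: 1 cheb_num_def Let_def)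
    have den: "cheb_den \<alpha> \<beta> = (\<lambda>t1 t2 t3. 1)"
      by (simp add: 1 cheb_den_def)
    show ?thesis
    proof (rule that[of "1 / 12"])
      fix k1 k2 :: nat and t1 t2 t3 :: real
      assume t: "t1 + t2 + t3 = 0"
      show "complex_of_real (cheb_num \<alpha> \<beta> k1 k2 t1 t2 t3)
          = 1 / 12 * cheb_weyl \<alpha> \<beta> k1 k2 (angles t1 t2 t3)"
        unfolding num by (subst gen_trig_eq_weyl(1)[OF _ t]) (simp_all add: 1 cheb_weyl_def
            wsign_def wshift_def algebra_simps)
      show "complex_of_real (cheb_den \<alpha> \<beta> t1 t2 t3)
          = 1 / 12 * cheb_weyl \<alpha> \<beta> 0 0 (angles t1 t2 t3)"
        unfolding den by (simp add: 1 cheb_weyl_def wsign_def wshift_def const)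
    qed simp
  next
    case 2
    have num: "cheb_num \<alpha> \<beta> k1 k2 = SC (int k1 + int k2 + 1) (int k2) (- int k1 - 2 * int k2
        - 1)" for k1 k2
      by (simp add: 2 cheb_num_def Let_def)
    have den: "cheb_den \<alpha> \<beta> = SC 1 0 (-1)"
      by (simp add: 2 cheb_den_def)
    show ?thesis
    proof (rule that[of "- \<i> / 12"])
      fix k1 k2 :: nat and t1 t2 t3 :: real
      assume t: "t1 + t2 + t3 = 0"
      show "complex_of_real (cheb_num \<alpha> \<beta> k1 k2 t1 t2 t3)
          = - \<i> / 12 * cheb_weyl \<alpha> \<beta> k1 k2 (angles t1 t2 t3)"
        unfolding num by (subst gen_trig_eq_weyl(2)[OF _ t]) (simp_all add: 2 cheb_weyl_def
            wsign_def wshift_def algebra_simps)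
      show "complex_of_real (cheb_den \<alpha> \<beta> t1 t2 t3)
          = - \<i> / 12 * cheb_weyl \<alpha> \<beta> 0 0 (angles t1 t2 t3)"
        unfolding den by (subst gen_trig_eq_weyl(2)[OF _ t]) (simp_all add: 2 cheb_weyl_def
            wsign_def wshift_def)
    qed simp
  next
    case 3
    have num: "cheb_num \<alpha> \<beta> k1 k2 = CS (int k1 + int k2 + 1) (int k2 + 1) (- int k1 - 2 * int k2
        - 2)" for k1 k2
      by (simp add: 3 cheb_num_def Let_def)
    have den: "cheb_den \<alpha> \<beta> = CS 1 1 (-2)"
      by (simp add: 3 cheb_den_def)
    show ?thesis
    proof (rule that[of "- \<i> / 12"])
      fix k1 k2 :: nat and t1 t2 t3 :: real
      assume t: "t1 + t2 + t3 = 0"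
      show "complex_of_real (cheb_num \<alpha> \<beta> k1 k2 t1 t2 t3)
          = - \<i> / 12 * cheb_weyl \<alpha> \<beta> k1 k2 (angles t1 t2 t3)"
        unfolding num by (subst gen_trig_eq_weyl(3)[OF _ t]) (simp_all add: 3 cheb_weyl_def
            wsign_def wshift_def algebra_simps)
      show "complex_of_real (cheb_den \<alpha> \<beta> t1 t2 t3)
          = - \<i> / 12 * cheb_weyl \<alpha> \<beta> 0 0 (angles t1 t2 t3)"
        unfolding den by (subst gen_trig_eq_weyl(3)[OF _ t]) (simp_all add: 3 cheb_weyl_def
            wsign_def wshift_def)
    qed simp
  next
    case 4
    have num: "cheb_num \<alpha> \<beta> k1 k2 = SS (int k1 + int k2 + 2) (int k2 + 1) (- int k1 - 2 * int k2
        - 3)" for k1 k2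
      by (simp add: 4 cheb_num_def Let_def)
    have den: "cheb_den \<alpha> \<beta> = SS 2 1 (-3)"
      by (simp add: 4 cheb_den_def)
    show ?thesis
    proof (rule that[of "- 1 / 12"])
      fix k1 k2 :: nat and t1 t2 t3 :: real
      assume t: "t1 + t2 + t3 = 0"
      show "complex_of_real (cheb_num \<alpha> \<beta> k1 k2 t1 t2 t3)
          = - 1 / 12 * cheb_weyl \<alpha> \<beta> k1 k2 (angles t1 t2 t3)"
        unfolding num by (subst gen_trig_eq_weyl(4)[OF _ t]) (simp_all add: 4 cheb_weyl_def
            wsign_def wshift_def algebra_simps)
      show "complex_of_real (cheb_den \<alpha> \<beta> t1 t2 t3)
          = - 1 / 12 * cheb_weyl \<alpha> \<beta> 0 0 (angles t1 t2 t3)"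
        unfolding den by (subst gen_trig_eq_weyl(4)[OF _ t]) (simp_all add: 4 cheb_weyl_def
            wsign_def wshift_def)
    qed simp
  qed
qed

text \<open>For \<open>x \<noteq> 0\<close> and the two admissible exponents this is
  \<open>\<bar>x\<bar> powr (2 * \<alpha> + 1)\<close>; unlike \<open>powr\<close> it stays
  \<open>1\<close> at \<open>x = 0\<close> when \<open>\<alpha> = -1/2\<close>.\<close>

definition delta_power :: "real \<Rightarrow> real \<Rightarrow> real" where
  "delta_power \<alpha> x = (if \<alpha> = 1/2 then x\<^sup>2 else 1)"

lemma norm_cheb_weyl_0:
  assumes "\<alpha> \<in> {-1/2, 1/2}" and "\<beta> \<in> {-1/2, 1/2}"
  obtains c where "c > 0" "\<And>z. (cmod (cheb_weyl \<alpha> \<beta> 0 0 z))\<^sup>2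
      = c * (delta_power \<alpha> (delta1 z) * delta_power \<beta> (delta2 z))"
proof -
  have const: "weyl 1 1 0 0 z = 12" for z
    by (simp add: weyl_def perm_sum_def rot_sum_def expi_def)
  consider "\<alpha> = -1/2" "\<beta> = -1/2" | "\<alpha> = 1/2" "\<beta> = -1/2" | "\<alpha> = -1/2" "\<beta> = 1/2" | "\<alpha> = 1/2" "\<beta>
      = 1/2"
    using assms by auto
  then show thesis
  proof cases
    case 1
    show ?thesis
      by (rule that[of 144]) (simp_all add: 1 cheb_weyl_def wsign_def wshift_def delta_power_def
          const)
  next
    case 2
    show ?thesis
      by (rule that[of 16]) (simp_all add: 2 cheb_weyl_def wsign_def wshift_def delta_power_def
          weyl_denominators norm_mult power_mult_distrib)
  next
    case 3
    show ?thesis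
      by (rule that[of 16]) (simp_all add: 3 cheb_weyl_def wsign_def wshift_def delta_power_def
          weyl_denominators norm_mult power_mult_distrib)
  next
    case 4
    show ?thesis
      by (rule that[of 16]) (simp_all add: 4 cheb_weyl_def wsign_def wshift_def delta_power_def
          weyl_denominators norm_mult power_mult_distrib)
  qed
qed

lemma cheb_weyl_0_nonzero:
  assumes "\<alpha> \<in> {-1/2, 1/2}" and "\<beta> \<in> {-1/2, 1/2}" and "z \<in> open_chamber"
  shows "cheb_weyl \<alpha> \<beta> 0 0 z \<noteq> 0"
proof -
  obtain c where c: "c > 0" "(cmod (cheb_weyl \<alpha> \<beta> 0 0 z))\<^sup>2
      = c * (delta_power \<alpha> (delta1 z) * delta_power \<beta> (delta2 z))"
    using norm_cheb_weyl_0[OF assms(1,2)] by metis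
  have "(cmod (cheb_weyl \<alpha> \<beta> 0 0 z))\<^sup>2 \<noteq> 0"
    unfolding c(2) using c(1) delta_nonzero[OF assms(3)] by (simp add: delta_power_def)
  then show ?thesis by simp
qed

text \<open>Resolves the definite description: existence comes from \<open>weyl_is_multiple\<close>,
  uniqueness from \<open>polynomial_unique\<close>. The product form also covers zeros of the
  denominator.\<close>

lemma cheb_weyl_eq_cheb_poly:
  assumes "\<alpha> \<in> {-1/2, 1/2}" and "\<beta> \<in> {-1/2, 1/2}"
  shows "cheb_weyl \<alpha> \<beta> k1 k2 z = cheb_weyl \<alpha> \<beta> 0 0 z * of_real (eval2 (cheb_poly \<alpha> \<beta> k1 k2)
      (xpq z) (ypq z))"
proof -
  define spec where "spec = (\<lambda>p. \<forall>t1 t2 t3. t1 + t2 + t3 = 0 \<and> cheb_den \<alpha> \<beta> t1 t2 t3 \<noteq> 0 \<longrightarrow>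
       eval2 p (x_of t1 t2 t3) (y_of t1 t2 t3) = cheb_num \<alpha> \<beta> k1 k2 t1 t2 t3 / cheb_den \<alpha> \<beta> t1 t2
           t3)"
  obtain \<kappa> where \<kappa>: "\<kappa> \<noteq> 0"
    "\<And>k1 k2 t1 t2 t3. t1 + t2 + t3 = 0 \<Longrightarrow>
      complex_of_real (cheb_num \<alpha> \<beta> k1 k2 t1 t2 t3) = \<kappa> * cheb_weyl \<alpha> \<beta> k1 k2 (angles t1 t2 t3)"
    "\<And>t1 t2 t3. t1 + t2 + t3 = 0 \<Longrightarrow>
      complex_of_real (cheb_den \<alpha> \<beta> t1 t2 t3) = \<kappa> * cheb_weyl \<alpha> \<beta> 0 0 (angles t1 t2 t3)"
    using cheb_num_den[OF assms] by metis
  \<comment> \<open>As \<open>angles\<close> is onto, the specification can be restated over all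
    points \<open>z\<close>.\<close>
  have spec_iff: "spec p \<longleftrightarrow> (\<forall>z. cheb_weyl \<alpha> \<beta> 0 0 z \<noteq> 0 \<longrightarrow>
      of_real (eval2 p (xpq z) (ypq z)) = cheb_weyl \<alpha> \<beta> k1 k2 z / cheb_weyl \<alpha> \<beta> 0 0 z)" for p
  proof -
    have point: "(cheb_den \<alpha> \<beta> t1 t2 t3 \<noteq> 0 \<longrightarrow>
       eval2 p (x_of t1 t2 t3) (y_of t1 t2 t3) = cheb_num \<alpha> \<beta> k1 k2 t1 t2 t3 / cheb_den \<alpha> \<beta> t1 t2
           t3)
      \<longleftrightarrow> (let z = angles t1 t2 t3 in cheb_weyl \<alpha> \<beta> 0 0 z \<noteq> 0 \<longrightarrow>
        of_real (eval2 p (xpq z) (ypq z)) = cheb_weyl \<alpha> \<beta> k1 k2 z / cheb_weyl \<alpha> \<beta> 0 0 z)"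
      if "t1 + t2 + t3 = 0" for t1 t2 t3
    proof -
      have "cheb_den \<alpha> \<beta> t1 t2 t3 = 0 \<longleftrightarrow> cheb_weyl \<alpha> \<beta> 0 0 (angles t1 t2 t3) = 0"
        using \<kappa>(1) \<kappa>(3)[OF that] by (metis mult_eq_0_iff of_real_eq_0_iff)
      moreover have "complex_of_real (cheb_num \<alpha> \<beta> k1 k2 t1 t2 t3 / cheb_den \<alpha> \<beta> t1 t2 t3)
        = cheb_weyl \<alpha> \<beta> k1 k2 (angles t1 t2 t3) / cheb_weyl \<alpha> \<beta> 0 0 (angles t1 t2 t3)"
        using \<kappa>(1) by (simp add: \<kappa>(2,3)[OF that])
      ultimately show ?thesis
        unfolding Let_def x_of_eq[OF that] y_of_eq[OF that]
        by (metis of_real_eq_iff)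
    qed
    show ?thesis
    proof
      assume spec: "spec p"
      show "\<forall>z. cheb_weyl \<alpha> \<beta> 0 0 z \<noteq> 0 \<longrightarrow>
        of_real (eval2 p (xpq z) (ypq z)) = cheb_weyl \<alpha> \<beta> k1 k2 z / cheb_weyl \<alpha> \<beta> 0 0 z"
      proof
        fix z
        obtain t1 t2 t3 where "t1 + t2 + t3 = 0" "angles t1 t2 t3 = z"
          using angles_surj by blast
        with spec point show "cheb_weyl \<alpha> \<beta> 0 0 z \<noteq> 0 \<longrightarrow>
          of_real (eval2 p (xpq z) (ypq z)) = cheb_weyl \<alpha> \<beta> k1 k2 z / cheb_weyl \<alpha> \<beta> 0 0 z"
          unfolding spec_def Let_def by blast
      qed
    next
      assume "\<forall>z. cheb_weyl \<alpha> \<beta> 0 0 z \<noteq> 0 \<longrightarrow>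
        of_real (eval2 p (xpq z) (ypq z)) = cheb_weyl \<alpha> \<beta> k1 k2 z / cheb_weyl \<alpha> \<beta> 0 0 z"
      with point show "spec p"
        unfolding spec_def Let_def by blast
    qed
  qed
  have "weyl_multiple (of_real (wsign \<alpha>)) (of_real (wsign \<alpha> * wsign \<beta>)) (wshift \<alpha> + wshift \<beta>)
      (wshift \<alpha> + 2 * wshift \<beta>)
    (cheb_weyl \<alpha> \<beta> k1 k2)"
    unfolding cheb_weyl_def
    using assms by (intro weyl_is_multiple wsign_cases) (auto simp: wsign_def wshift_def)
  then obtain P where P: "\<And>z. cheb_weyl \<alpha> \<beta> k1 k2 z
      = cheb_weyl \<alpha> \<beta> 0 0 z * of_real (eval2 P (xpq z) (ypq z))"
    unfolding weyl_multiple_def by (auto simp: cheb_weyl_def)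
  have "cheb_poly \<alpha> \<beta> k1 k2 = P"
    unfolding cheb_poly_def spec_def[symmetric]
  proof (rule the_equality)
    show "spec P"
      unfolding spec_iff by (simp add: P)
    fix Q assume Q: "spec Q"
    show "Q = P"
    proof (rule polynomial_unique)
      fix z assume "z \<in> open_chamber"
      then have "cheb_weyl \<alpha> \<beta> 0 0 z \<noteq> 0"
        using cheb_weyl_0_nonzero[OF assms] by blast
      moreover from this Q have "complex_of_real (eval2 Q (xpq z) (ypq z))
          = cheb_weyl \<alpha> \<beta> k1 k2 z / cheb_weyl \<alpha> \<beta> 0 0 z"
        unfolding spec_iff by blast
      ultimately have "complex_of_real (eval2 Q (xpq z) (ypq z))
          = of_real (eval2 P (xpq z) (ypq z))"
        by (simp add: P)
      then show "eval2 Q (xpq z) (ypq z) = eval2 P (xpq z) (ypq z)"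
        by (simp only: of_real_eq_iff)
    qed
  qed
  then show ?thesis using P by simp
qed

section \<open>The weight under the change of variables\<close>

lemma abs_mult_powr_square:
  assumes "\<alpha> \<in> {-1/2, 1/2}" "x \<noteq> 0" "c > 0"
  shows "\<bar>x\<bar> * (x\<^sup>2 / c) powr \<alpha> = delta_power \<alpha> x / c powr \<alpha>"
proof -
  have "x\<^sup>2 = \<bar>x\<bar> powr 2"
    using assms by simp
  then have "(x\<^sup>2) powr \<alpha> = \<bar>x\<bar> powr (2 * \<alpha>)"
    by (simp only: powr_powr)
  also have "\<bar>x\<bar> * \<dots> = delta_power \<alpha> x"
  proof (cases "\<alpha> = 1 / 2")
    case True
    then have eq: "2 * \<alpha> = 1" by simp
    show ?thesis unfolding eq using True by (simp add: delta_power_def power2_eq_square)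
  next
    case False
    then have eq: "2 * \<alpha> = - 1" using assms(1) by simp
    show ?thesis
      unfolding eq using assms(2) False by (simp add: delta_power_def powr_minus)
  qed
  finally show ?thesis
    by (simp add: powr_divide)
qed

text \<open>The Jacobian times the weight is a multiple of the squared denominator, exactly what
  clears the denominators of the two polynomials in an inner product.\<close>

lemma weight_jacobian:
  assumes "\<alpha> \<in> {-1/2, 1/2}" and "\<beta> \<in> {-1/2, 1/2}"
  obtains K where "K > 0" "\<And>z. z \<in> open_chamber \<Longrightarrow>
    \<bar>delta1 z * delta2 z / 9\<bar> * weight \<alpha> \<beta> (xypq z) = K * (cmod (cheb_weyl \<alpha> \<beta> 0 0 z))\<^sup>2"
proof -
  obtain c where c: "c > 0" "\<And>z. (cmod (cheb_weyl \<alpha> \<beta> 0 0 z))\<^sup>2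
      = c * (delta_power \<alpha> (delta1 z) * delta_power \<beta> (delta2 z))"
    using norm_cheb_weyl_0[OF assms] by metis
  define K where "K = (4 * pi\<^sup>2) powr (\<alpha> + \<beta>) / 3 powr (2 * \<alpha> + \<beta>) / 9 / 3 powr \<alpha> / 9 powr \<beta> / c"
  show thesis
  proof (rule that)
    show "K > 0" using c(1) by (simp add: K_def)
    fix z assume z: "z \<in> open_chamber"
    have factors: "1 + 2 * ypq z - 3 * (xpq z)\<^sup>2 = (delta1 z)\<^sup>2 / 3"
      "24 * (xpq z)^3 - (ypq z)\<^sup>2 - 12 * xpq z * ypq z - 6 * xpq z - 4 * ypq z - 1
          = (delta2 z)\<^sup>2 / 9"
      using weight_factor1[of "fst z" "snd z"] weight_factor2[of "fst z" "snd z"]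
      by (simp_all only: prod.collapse)
    have "weight \<alpha> \<beta> (xypq z) = (4 * pi\<^sup>2) powr (\<alpha> + \<beta>) / 3 powr (2 * \<alpha> + \<beta>)
        * ((delta1 z)\<^sup>2 / 3) powr \<alpha> * ((delta2 z)\<^sup>2 / 9) powr \<beta>"
      unfolding weight_def xypq_def prod.case factors ..
    then have "\<bar>delta1 z * delta2 z / 9\<bar> * weight \<alpha> \<beta> (xypq z)
        = (4 * pi\<^sup>2) powr (\<alpha> + \<beta>) / 3 powr (2 * \<alpha> + \<beta>) / 9
        * (\<bar>delta1 z\<bar> * ((delta1 z)\<^sup>2 / 3) powr \<alpha>) * (\<bar>delta2 z\<bar> * ((delta2 z)\<^sup>2 / 9) powr \<beta>)"
      by (simp add: abs_mult ac_simps)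
    also have "\<dots> = K * (cmod (cheb_weyl \<alpha> \<beta> 0 0 z))\<^sup>2"
      using c(1) unfolding abs_mult_powr_square[OF assms(1) delta_nonzero(1)[OF z]
          zero_less_numeral]
        abs_mult_powr_square[OF assms(2) delta_nonzero(2)[OF z] zero_less_numeral] c(2) K_def
          by simp
    finally show "\<bar>delta1 z * delta2 z / 9\<bar> * weight \<alpha> \<beta> (xypq z)
        = K * (cmod (cheb_weyl \<alpha> \<beta> 0 0 z))\<^sup>2" .
  qed
qed

subsection \<open>Orthogonality\<close>

lemma continuous_on_weyl [continuous_intros]: "continuous_on S (weyl s h m n)"
  unfolding weyl_def[abs_def] perm_sum_def rot_sum_def expi_def cis_conv_exp
    by (intro continuous_intros)

lemma continuous_on_eval2 [continuous_intros]: "continuous_on S (\<lambda>z. eval2 P (fst z) (snd z))"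
proof (induction P)
  case 0
  show ?case by simp
next
  case (pCons c P)
  have "eval2 (pCons c P) x y = poly c x + y * eval2 P x y" for x y
    by (simp add: eval2_def)
  then show ?case
    using pCons by (auto intro!: continuous_intros)
qed

section \<open>Integrals of products of numerators\<close>

definition area :: real where
  "area = (LINT z:chamber|lborel. 1)"

lemma area_pos: "area > 0"
proof -
  let ?B = "cbox (pi / 8, pi / 4) (pi / 4, pi / 2)"
  have B: "?B \<subseteq> chamber"
    by (auto simp: chamber_def cbox_Pair_eq)
  have fin: "emeasure lborel chamber < \<infinity>"
    using compact_chamber by (intro emeasure_bounded_finite compact_imp_bounded)
  have "0 < measure lborel ?B"
    by (simp add: content_Pair flip: cbox_Pair_eq)
  also have "\<dots> \<le> measure lborel chamber"
    using B fin by (intro measure_mono_fmeasurable) (auto simp: fmeasurable_def)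
  also have "\<dots> = area"
    unfolding area_def set_lebesgue_integral_def by simp
  finally show ?thesis .
qed

lemma integral_cos_orbit:
  "(LINT z:chamber|lborel. cos_orbit m n z) = (if m = 0 \<and> n = 0 then 6 * area else 0)"
proof (cases "m = 0 \<and> n = 0")
  case True
  then have "cos_orbit m n z = 6 * 1" for z
    by (simp add: cos_orbit_def cos_form_def)
  then show ?thesis
    using True by (simp only: set_integral_mult_right area_def) simp
next
  case False
  then show ?thesis using integral_cos_orbit_eq_0[of m n] by auto
qed

lemma integrable_cos_orbit: "set_integrable lborel chamber (cos_orbit m n)"
  by (intro integrable_chamber continuous_intros)

text \<open>Conjugation costs only the sign \<open>h\<close>, and the square of the character is
  trivial. The product formula thus gives invariant sums, each with integral
  \<open>12 * area\<close> at weight zero and \<open>0\<close> otherwise.\<close>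

lemma integral_weyl_product:
  assumes "s \<in> {1, -1}" "h \<in> {1, -1}"
  defines "e \<equiv> \<lambda>i j::int. if i = 0 \<and> j = 0 then 1 else 0 :: real"
  shows "(LINT z:chamber|lborel. Re (weyl (of_real s) (of_real h) a b z
      * cnj (weyl (of_real s) (of_real h) m n z)))
    = 12 * area * h * (e (a + m) (b + n) + e (a + n - m) (b - m) + e (a - n) (b + m - n)
    + s * (e (a - n) (b - m) + e (a + m) (b + m - n) + e (a + n - m) (b + n))
    + h * (e (a - m) (b - n) + e (a + m - n) (b + m) + e (a + n) (b + n - m))
    + s * h * (e (a + n) (b + m) + e (a + m - n) (b - n) + e (a - m) (b + n - m)))"
proof -
  have sh: "complex_of_real s \<in> {1, -1}" "complex_of_real h \<in> {1, -1}"
    "complex_of_real s * complex_of_real s = 1" "complex_of_real h * complex_of_real h = 1"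
    using assms(1,2) by auto
  define W where "W = (\<lambda>f. f (a + m) (b + n) + f (a + n - m) (b - m) + f (a - n) (b + m - n)
    + s * (f (a - n) (b - m) + f (a + m) (b + m - n) + f (a + n - m) (b + n))
    + h * (f (a - m) (b - n) + f (a + m - n) (b + m) + f (a + n) (b + n - m))
    + s * h * (f (a + n) (b + m) + f (a + m - n) (b - n) + f (a - m) (b + n - m)) :: real)"
  have "Re (weyl (of_real s) (of_real h) a b z * cnj (weyl (of_real s) (of_real h) m n z))
      = h * (2 * W (\<lambda>i j. cos_orbit i j z))" for z
  proof -
    have "weyl (of_real s) (of_real h) a b z * cnj (weyl (of_real s) (of_real h) m n z)
      = of_real h * (weyl (of_real s) (of_real h) a b z * weyl (of_real s) (of_real h) m n z)"
      unfolding cnj_weyl[OF sh(1,2)] by (simp add: ac_simps)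
    also have "\<dots> = of_real (h * (2 * W (\<lambda>i j. cos_orbit i j z)))"
      unfolding weyl_mult[OF sh(1,2)] sh(3,4) weyl_eq_cos_orbit W_def by (simp add: algebra_simps)
    finally show ?thesis by (simp only: Re_complex_of_real)
  qed
  then have "(LINT z:chamber|lborel. Re (weyl (of_real s) (of_real h) a b z
      * cnj (weyl (of_real s) (of_real h) m n z)))
    = h * (2 * (LINT z:chamber|lborel. W (\<lambda>i j. cos_orbit i j z)))"
    by simp
  also have "(LINT z:chamber|lborel. W (\<lambda>i j. cos_orbit i j z)) = W (\<lambda>i j. 6 * area * e i j)"
  proof -
    \<comment> \<open>Integrability and value travel together, so both follow the structure of
      \<open>W\<close>.\<close>
    define I where "I = (\<lambda>(f :: real \<times> real \<Rightarrow> real) x. set_integrable lborel chamber f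
        \<and> (LINT z:chamber|lborel. f z) = x)"
    have I_add: "I (\<lambda>z. f z + g z) (x + y)" if "I f x" "I g y" for f g :: "real \<times> real \<Rightarrow> real"
        and x y
      using that by (simp add: I_def set_integral_add)
    have I_mult: "I (\<lambda>z. c * f z) (c * x)" if "I f x" for f :: "real \<times> real \<Rightarrow> real" and c x
      using that by (simp add: I_def)
    have I_orbit: "I (\<lambda>z. cos_orbit i j z) (6 * area * e i j)" for i j
      by (simp add: I_def integrable_cos_orbit integral_cos_orbit e_def)
    have "I (\<lambda>z. W (\<lambda>i j. cos_orbit i j z)) (W (\<lambda>i j. 6 * area * e i j))"
      unfolding W_def by (intro I_add I_mult I_orbit)
    then show ?thesis by (simp add: I_def)
  qed
  also have "W (\<lambda>i j. 6 * area * e i j) = 6 * area * W e"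
    by (simp add: W_def algebra_simps)
  finally show ?thesis
    by (simp add: W_def)
qed

text \<open>A weight in the product formula is zero when a group element sends one dominant weight
  to the negative of the other. As \<open>- 1\<close> is in the group, the two must then be equal,
  and the number of such elements is the order of the stabilizer: 12 at the origin, 2 elsewhere on a
  wall, 1 inside. Thus \<open>d\<close> is this order divided by 12.\<close>

lemma integral_cheb_weyl:
  assumes "\<alpha> \<in> {-1/2, 1/2}" and "\<beta> \<in> {-1/2, 1/2}"
  shows "(LINT z:chamber|lborel. Re (cheb_weyl \<alpha> \<beta> k1 k2 z * cnj (cheb_weyl \<alpha> \<beta> j1 j2 z)))
    = 144 * area * (d \<alpha> \<beta> k1 k2 * (if k1 = j1 then 1 else 0) * (if k2 = j2 then 1 else 0))"
proof -
  define a b a' b' where "a = int k1 + wshift \<alpha>" and "b = int k2 + wshift \<beta>"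
    and "a' = int j1 + wshift \<alpha>" and "b' = int j2 + wshift \<beta>"
  have nonneg: "a \<ge> 0" "b \<ge> 0" "a' \<ge> 0" "b' \<ge> 0"
    by (simp_all add: a_def b_def a'_def b'_def wshift_def)
  let ?m = "a + b" and ?n = "a + 2 * b" and ?m' = "a' + b'" and ?n' = "a' + 2 * b'"
  let ?z = "a = 0 \<and> b = 0 \<and> a' = 0 \<and> b' = 0"
  have stab:
    "?m + ?m' = 0 \<and> ?n + ?n' = 0 \<longleftrightarrow> ?z" "?m + ?n' - ?m' = 0 \<and> ?n - ?m' = 0 \<longleftrightarrow> ?z"
    "?m - ?n' = 0 \<and> ?n + ?m' - ?n' = 0 \<longleftrightarrow> ?z"
    "?m - ?n' = 0 \<and> ?n - ?m' = 0 \<longleftrightarrow> a = a' \<and> b = b' \<and> b = 0"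
    "?m + ?m' = 0 \<and> ?n + ?m' - ?n' = 0 \<longleftrightarrow> ?z" "?m + ?n' - ?m' = 0 \<and> ?n + ?n' = 0 \<longleftrightarrow> ?z"
    "?m - ?m' = 0 \<and> ?n - ?n' = 0 \<longleftrightarrow> a = a' \<and> b = b'"
    "?m + ?m' - ?n' = 0 \<and> ?n + ?m' = 0 \<longleftrightarrow> ?z" "?m + ?n' = 0 \<and> ?n + ?n' - ?m' = 0 \<longleftrightarrow> ?z"
    "?m + ?n' = 0 \<and> ?n + ?m' = 0 \<longleftrightarrow> ?z"
    "?m + ?m' - ?n' = 0 \<and> ?n - ?n' = 0 \<longleftrightarrow> a = a' \<and> b = b' \<and> a = 0"
    "?m - ?m' = 0 \<and> ?n + ?n' - ?m' = 0 \<longleftrightarrow> ?z"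
    using nonneg by auto
  have h: "wsign \<alpha> * wsign \<beta> \<in> {1, - 1}"
    by (auto simp: wsign_def)
  have eq: "a = a' \<longleftrightarrow> k1 = j1" "b = b' \<longleftrightarrow> k2 = j2"
    by (auto simp: a_def b_def a'_def b'_def)
  have zero: "a = 0 \<longleftrightarrow> k1 = 0 \<and> \<alpha> \<noteq> 1/2" "b = 0 \<longleftrightarrow> k2 = 0 \<and> \<beta> \<noteq> 1/2"
    "a' = 0 \<longleftrightarrow> j1 = 0 \<and> \<alpha> \<noteq> 1/2" "b' = 0 \<longleftrightarrow> j2 = 0 \<and> \<beta> \<noteq> 1/2"
    by (auto simp: a_def b_def a'_def b'_def wshift_def)
  show ?thesis
    unfolding cheb_weyl_def a_def[symmetric] b_def[symmetric] a'_def[symmetric] b'_def[symmetric]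
      integral_weyl_product[OF wsign_cases(1) h] stab eq zero
    using assms by (auto simp: d_def wsign_def)
qed

text \<open>\<open>K\<close> is chosen before the indices, so the normalization integral contains
  the same factor.\<close>

lemma integral_triangle_star:
  assumes "\<alpha> \<in> {-1/2, 1/2}" and "\<beta> \<in> {-1/2, 1/2}"
  shows "\<exists>K>0. \<forall>k1 k2 j1 j2. (LINT w:triangle_star|lborel. eval2 (cheb_poly \<alpha> \<beta> k1 k2) (fst w)
      (snd w)
        * eval2 (cheb_poly \<alpha> \<beta> j1 j2) (fst w) (snd w) * weight \<alpha> \<beta> w)
      = K * (LINT z:chamber|lborel. Re (cheb_weyl \<alpha> \<beta> k1 k2 z * cnj (cheb_weyl \<alpha> \<beta> j1 j2 z)))"
proof -
  obtain K where K: "K > 0" "\<And>z. z \<in> open_chamber \<Longrightarrow>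
    \<bar>delta1 z * delta2 z / 9\<bar> * weight \<alpha> \<beta> (xypq z) = K * (cmod (cheb_weyl \<alpha> \<beta> 0 0 z))\<^sup>2"
    using weight_jacobian[OF assms] by metis
  show ?thesis
  proof (intro exI[of _ K] conjI K(1) allI)
    fix k1 k2 j1 j2
    define f where "f = (\<lambda>w. eval2 (cheb_poly \<alpha> \<beta> k1 k2) (fst w) (snd w)
        * eval2 (cheb_poly \<alpha> \<beta> j1 j2) (fst w) (snd w) * weight \<alpha> \<beta> w)"
    define R where "R = (\<lambda>z. Re (cheb_weyl \<alpha> \<beta> k1 k2 z * cnj (cheb_weyl \<alpha> \<beta> j1 j2 z)))"
    define Xp Xq Yp Yq where "Xp = (\<lambda>z::real \<times> real. - (sin (fst z) + sin (fst z + snd z)) / 3)"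
      and "Xq = (\<lambda>z::real \<times> real. - (sin (snd z) + sin (fst z + snd z)) / 3)"
      and "Yp = (\<lambda>z::real \<times> real. (sin (snd z - fst z) - 2 * sin (2 * fst z + snd z) - sin (fst z
          + 2 * snd z)) / 3)"
      and "Yq = (\<lambda>z::real \<times> real. - (sin (snd z - fst z) + sin (2 * fst z + snd z) + 2
          * sin (fst z + 2 * snd z)) / 3)"
    have jac: "Xp z * Yq z - Xq z * Yp z = delta1 z * delta2 z / 9" for z
      using jacobian_identity[of "fst z" "snd z"]
      by (simp add: Xp_def Xq_def Yp_def Yq_def field_simps)
    have cont_xypq: "continuous_on S xypq" for S
      unfolding xypq_def xpq_def ypq_def by (intro continuous_intros) auto
    have [measurable]: "xypq \<in> borel_measurable borel"
      by (intro borel_measurable_continuous_onI cont_xypq)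
    have [measurable]: "(\<lambda>w. eval2 P (fst w) (snd w)) \<in> borel_measurable borel" for P
      by (intro borel_measurable_continuous_onI continuous_intros)
    have "(\<lambda>w. weight \<alpha> \<beta> w) \<in> borel_measurable (borel \<Otimes>\<^sub>M borel)"
      unfolding weight_def by measurable
    then have [measurable]: "weight \<alpha> \<beta> \<in> borel_measurable borel"
      by (simp add: borel_prod)
    have [measurable]: "f \<in> borel_measurable borel"
      unfolding f_def by measurable
    have [measurable]: "delta1 \<in> borel_measurable borel" "delta2 \<in> borel_measurable borel"
      unfolding delta1_def[abs_def] delta2_def[abs_def]
      by (intro borel_measurable_continuous_onI continuous_intros)+
    have cont_R: "continuous_on UNIV R"
      unfolding R_def cheb_weyl_def by (intro continuous_intros)
    \<comment> \<open>On the edges the left side vanishes with the Jacobian, while the right side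
      need not. The edges lie on three lines of measure zero.\<close>
    have AE_eq: "AE z in lborel. indicator chamber z *\<^sub>R (\<bar>delta1 z * delta2 z / 9\<bar> * f (xypq z))
        = indicator chamber z *\<^sub>R (K * R z)"
    proof -
      have "AE z in lborel. z \<notin> H" if "H = {z. c \<bullet> z = b}" "c \<noteq> 0" for H and c :: "real \<times> real"
          and b
      proof -
        have "H \<in> sets borel"
          unfolding that(1) by (intro borel_closed closed_hyperplane)
        moreover have "negligible H"
          unfolding that(1) using that(2) by (intro negligible_hyperplane) simp
        ultimately have "H \<in> null_sets lborel"
          by (simp add: negligible_iff_null_sets null_sets_completion_iff)
        then show ?thesis by (rule AE_not_in)
      qed
      from this[OF refl, of "(1, 0)" 0] this[OF refl, of "(1, -1)" 0] this[OF refl, of "(1, 2)"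
          "2 * pi"]
      have "AE z in lborel. fst z \<noteq> 0 \<and> fst z \<noteq> snd z \<and> fst z + 2 * snd z \<noteq> 2 * pi"
        by (simp add: inner_prod_def zero_prod_def)
      then show ?thesis
      proof eventually_elim
        case (elim z)
        show ?case
        proof (cases "z \<in> chamber")
          case True
          then have z: "z \<in> open_chamber"
            using elim by (auto simp: chamber_def open_chamber_def)
          have "complex_of_real (R z) = complex_of_real ((cmod (cheb_weyl \<alpha> \<beta> 0 0 z))\<^sup>2
              * (eval2 (cheb_poly \<alpha> \<beta> k1 k2) (xpq z) (ypq z) * eval2 (cheb_poly \<alpha> \<beta> j1 j2)
                  (xpq z) (ypq z)))"
            (is "_ = of_real ?r")
          proof -
            have "cheb_weyl \<alpha> \<beta> k1 k2 z * cnj (cheb_weyl \<alpha> \<beta> j1 j2 z) = of_real ?r"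
              unfolding cheb_weyl_eq_cheb_poly[OF assms, of k1 k2] cheb_weyl_eq_cheb_poly[OF
                  assms, of j1 j2]
                of_real_mult complex_norm_square by simp
            then show ?thesis
              unfolding R_def by simp
          qed
          then have "R z = ?r" by (simp only: of_real_eq_iff)
          moreover have "\<bar>delta1 z * delta2 z / 9\<bar> * f (xypq z)
              = (\<bar>delta1 z * delta2 z / 9\<bar> * weight \<alpha> \<beta> (xypq z))
              * (eval2 (cheb_poly \<alpha> \<beta> k1 k2) (xpq z) (ypq z) * eval2 (cheb_poly \<alpha> \<beta> j1 j2)
                  (xpq z) (ypq z))"
            by (simp add: f_def xypq_def)
          ultimately show ?thesis
            unfolding K(2)[OF z] by simp
        qed simp
      qed
    qed
    have meas: "(\<lambda>z. indicator chamber z *\<^sub>R (\<bar>delta1 z * delta2 z / 9\<bar> * f (xypq z))) \<in>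
        borel_measurable lborel"
      by measurable
    have meas_R [measurable]: "R \<in> borel_measurable borel"
      by (intro borel_measurable_continuous_onI cont_R)
    have int_R: "set_integrable lborel chamber (\<lambda>z. K * R z)"
      by (intro integrable_chamber continuous_intros cont_R)
    have "(LINT w:triangle_star|lborel. f w) = (LINT z:chamber|lborel. \<bar>Xp z * Yq z - Xq z
        * Yp z\<bar> * f (xypq z))"
      unfolding triangle_star_eq
    proof (rule integral_change_of_variables_pair)
      show "xypq ` chamber \<in> sets borel"
        using compact_continuous_image[OF cont_xypq compact_chamber] by (rule borel_compact)
      show "(xypq has_derivative (\<lambda>h. (Xp z * fst h + Xq z * snd h, Yp z * fst h + Yq z
          * snd h))) (at z within chamber)" for z
        unfolding xypq_def xpq_def ypq_def Xp_def Xq_def Yp_def Yq_def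
        by (auto intro!: derivative_eq_intros simp: algebra_simps add_divide_distrib
            diff_divide_distrib fun_eq_iff)
      \<comment> \<open>The pulled-back integrand may involve a singular weight, but almost
        everywhere it equals a continuous function on a compact set.\<close>
      show "set_integrable lborel chamber (\<lambda>z. \<bar>Xp z * Yq z - Xq z * Yp z\<bar> * f (xypq z))"
        unfolding jac set_integrable_def
        by (subst integrable_cong_AE[OF meas _ AE_eq]) (use int_R in \<open>simp_all add:
            set_integrable_def\<close>)
    qed (simp_all add: xypq_inj jac)
    also have "\<dots> = (LINT z:chamber|lborel. K * R z)"
      unfolding jac set_lebesgue_integral_def
      by (intro integral_cong_AE meas AE_eq) simp
    also have "\<dots> = K * (LINT z:chamber|lborel. R z)"
      by simp
    finally show "(LINT w:triangle_star|lborel. eval2 (cheb_poly \<alpha> \<beta> k1 k2) (fst w) (snd w)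
        * eval2 (cheb_poly \<alpha> \<beta> j1 j2) (fst w) (snd w) * weight \<alpha> \<beta> w)
      = K * (LINT z:chamber|lborel. Re (cheb_weyl \<alpha> \<beta> k1 k2 z * cnj (cheb_weyl \<alpha> \<beta> j1 j2 z)))"
      unfolding f_def R_def .
  qed
qed

lemma cheb_poly_0:
  assumes "\<alpha> \<in> {-1/2, 1/2}" and "\<beta> \<in> {-1/2, 1/2}"
  shows "cheb_poly \<alpha> \<beta> 0 0 = [:[:1:]:]"
proof (rule polynomial_unique)
  fix z assume "z \<in> open_chamber"
  with cheb_weyl_eq_cheb_poly[OF assms, of 0 0 z] cheb_weyl_0_nonzero[OF assms, of z]
  have "complex_of_real (eval2 (cheb_poly \<alpha> \<beta> 0 0) (xpq z) (ypq z)) = 1"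
    by simp
  then show "eval2 (cheb_poly \<alpha> \<beta> 0 0) (xpq z) (ypq z) = eval2 [:[:1:]:] (xpq z) (ypq z)"
    by simp
qed

theorem theorem4p4:
  fixes \<alpha> \<beta> :: real and k1 k2 j1 j2 :: nat
  assumes "\<alpha> \<in> {-1/2, 1/2}" and "\<beta> \<in> {-1/2, 1/2}"
  shows "weighted_inner \<alpha> \<beta> (cheb \<alpha> \<beta> k1 k2) (cheb \<alpha> \<beta> j1 j2) =
    complex_of_real (d \<alpha> \<beta> k1 k2 / d \<alpha> \<beta> 0 0 *
      (if k1 = j1 then 1 else 0) * (if k2 = j2 then 1 else 0))"
proof -
  obtain K where K: "K > 0"
    "\<forall>k1 k2 j1 j2. (LINT w:triangle_star|lborel. eval2 (cheb_poly \<alpha> \<beta> k1 k2) (fst w) (snd w)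
        * eval2 (cheb_poly \<alpha> \<beta> j1 j2) (fst w) (snd w) * weight \<alpha> \<beta> w)
      = K * (LINT z:chamber|lborel. Re (cheb_weyl \<alpha> \<beta> k1 k2 z * cnj (cheb_weyl \<alpha> \<beta> j1 j2 z)))"
    using integral_triangle_star[OF assms] by blast
  \<comment> \<open>With all indices zero the integrand is the weight itself. In the final quotient
    \<open>K\<close> and \<open>144 * area\<close> cancel and the divisor
    \<open>d \<alpha> \<beta> 0 0\<close> remains.\<close>
  have total: "(LINT w:triangle_star|lborel. weight \<alpha> \<beta> w) = K * (144 * area * d \<alpha> \<beta> 0 0)"
    using K(2)[rule_format, of 0 0 0 0, unfolded integral_cheb_weyl[OF assms] cheb_poly_0[OF
        assms]] by simp
  have "(LINT w:triangle_star|lborel. cheb \<alpha> \<beta> k1 k2 w * cnj (cheb \<alpha> \<beta> j1 j2 w) * complex_of_real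
      (weight \<alpha> \<beta> w))
    = (LINT w:triangle_star|lborel. complex_of_real (eval2 (cheb_poly \<alpha> \<beta> k1 k2) (fst w) (snd w)
        * eval2 (cheb_poly \<alpha> \<beta> j1 j2) (fst w) (snd w) * weight \<alpha> \<beta> w))"
    by (simp add: cheb_def)
  also have "\<dots> = complex_of_real (K * (144 * area * (d \<alpha> \<beta> k1 k2 * (if k1 = j1 then 1 else 0)
      * (if k2 = j2 then 1 else 0))))"
    unfolding set_integral_complex_of_real K(2)[rule_format] integral_cheb_weyl[OF assms] ..
  finally show ?thesis
    unfolding weighted_inner_def norm_const_def total
    using K(1) area_pos by (simp only: of_real_mult[symmetric] of_real_eq_iff) simp
qed

end
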